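(* Graph Isomorphism is Graph Isomorphism-complete for the class of $(\overline{2P_1+P_2},P_2+P_4)$-free graphs.
   Context: Given graphs $H_1,H_2$, a graph is $(H_1,H_2)$-free if it contains no induced subgraph isomorphic to $H_1$ or $H_2$. $\overline{G}$ denotes the complement of $G$; $P_r$ is the path on $r$ vertices; $G+H$ is disjoint union and $rG$ is the disjoint union of $r$ copies of $G$. The graph $\overline{2P_1+P_2}$ is the diamond. *)

theory Defs
  imports Main "HOL-Computational_Algebra.Polynomial"
begin

section \<open>Finite simple graphs\<close>

record 'a graph =
  verts :: "'a set"
  edges :: "'a set set"

definition simple_graph :: "'a graph \<Rightarrow> bool" where
  "simple_graph G \<longleftrightarrow> finite (verts G) \<and> edges G \<subseteq> {e. e \<subseteq> verts G \<and> card e = 2}"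

definition isomorphic :: "'a graph \<Rightarrow> 'b graph \<Rightarrow> bool" where
  "isomorphic G H \<longleftrightarrow>
     (\<exists>f. bij_betw f (verts G) (verts H) \<and>
          (\<forall>u\<in>verts G. \<forall>v\<in>verts G. {u, v} \<in> edges G \<longleftrightarrow> {f u, f v} \<in> edges H))"

definition induced :: "'a graph \<Rightarrow> 'a set \<Rightarrow> 'a graph" where
  "induced G S = \<lparr>verts = S, edges = {e \<in> edges G. e \<subseteq> S}\<rparr>"

definition free_of :: "'b graph \<Rightarrow> 'a graph \<Rightarrow> bool" where
  "free_of H G \<longleftrightarrow> \<not> (\<exists>S\<subseteq>verts G. isomorphic (induced G S) H)"

definition complement :: "'a graph \<Rightarrow> 'a graph" where
  "complement G =
     \<lparr>verts = verts G, edges = {e. e \<subseteq> verts G \<and> card e = 2 \<and> e \<notin> edges G}\<rparr>"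

definition disjoint_union :: "'a graph \<Rightarrow> 'b graph \<Rightarrow> ('a + 'b) graph" where
  "disjoint_union G H =
     \<lparr>verts = Inl ` verts G \<union> Inr ` verts H,
      edges = (`) Inl ` edges G \<union> (`) Inr ` edges H\<rparr>"

definition copies :: "nat \<Rightarrow> 'a graph \<Rightarrow> (nat \<times> 'a) graph" where
  "copies r G =
     \<lparr>verts = {..<r} \<times> verts G, edges = {Pair i ` e | i e. i < r \<and> e \<in> edges G}\<rparr>"

definition path_graph :: "nat \<Rightarrow> nat graph" where
  "path_graph r = \<lparr>verts = {..<r}, edges = {{i, Suc i} | i. Suc i < r}\<rparr>"


section \<open>Deterministic multi-tape Turing machines\<close>

datatype move = MoveLeft | Stay | MoveRight

text \<open>
  States are the numbers below \<open>num_states\<close> and tape symbols the numbers below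
  \<open>num_symbols\<close>. Symbol 0 is the blank; symbols 1 and 2 are the bits. The transition
  function maps a state and the list of scanned symbols (one for each tape) to the new
  state and, for each tape, the symbol to write and the head movement.
\<close>

record tm =
  num_tapes :: nat
  num_states :: nat
  num_symbols :: nat
  start_state :: nat
  halt_state :: nat
  delta :: "nat \<Rightarrow> nat list \<Rightarrow> nat \<times> (nat \<times> move) list"

definition valid_tm :: "tm \<Rightarrow> bool" where
  "valid_tm M \<longleftrightarrow>
     0 < num_tapes M \<and> 3 \<le> num_symbols M \<and>
     start_state M < num_states M \<and> halt_state M < num_states M \<and>
     (\<forall>q syms. q < num_states M \<and> length syms = num_tapes M \<and>
         set syms \<subseteq> {..<num_symbols M} \<longrightarrow>
       fst (delta M q syms) < num_states M \<and>
       length (snd (delta M q syms)) = num_tapes M \<and>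
       fst ` set (snd (delta M q syms)) \<subseteq> {..<num_symbols M})"

text \<open>A tape is a head position together with the contents of a two-way infinite tape.\<close>

type_synonym tape = "int \<times> (int \<Rightarrow> nat)"
type_synonym config = "nat \<times> tape list"

definition scanned :: "tape \<Rightarrow> nat" where
  "scanned T = snd T (fst T)"

fun shift :: "move \<Rightarrow> int \<Rightarrow> int" where
  "shift MoveLeft h = h - 1"
| "shift Stay h = h"
| "shift MoveRight h = h + 1"

definition act :: "nat \<times> move \<Rightarrow> tape \<Rightarrow> tape" where
  "act a T = (shift (snd a) (fst T), (snd T)(fst T := fst a))"

definition step :: "tm \<Rightarrow> config \<Rightarrow> config" where
  "step M c =
     (if fst c = halt_state M then c
      else let (q, as) = delta M (fst c) (map scanned (snd c)) in (q, map2 act as (snd c)))"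

fun bit_symbol :: "bool \<Rightarrow> nat" where
  "bit_symbol False = 1"
| "bit_symbol True = 2"

definition blank_tape :: tape where
  "blank_tape = (0, \<lambda>_. 0)"

definition input_tape :: "bool list \<Rightarrow> tape" where
  "input_tape w =
     (0, \<lambda>i. if 0 \<le> i \<and> i < int (length w) then bit_symbol (w ! nat i) else 0)"

definition init_config :: "tm \<Rightarrow> bool list \<Rightarrow> config" where
  "init_config M w = (start_state M, input_tape w # replicate (num_tapes M - 1) blank_tape)"

text \<open>The output is read off the first tape, from the head rightwards up to the first blank.\<close>

definition has_output :: "config \<Rightarrow> bool list \<Rightarrow> bool" where
  "has_output c w \<longleftrightarrow>
     (let (h, s) = hd (snd c) in
       (\<forall>i<length w. s (h + int i) = bit_symbol (w ! i)) \<and> s (h + int (length w)) = 0)"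

definition computes_within :: "tm \<Rightarrow> bool list \<Rightarrow> bool list \<Rightarrow> nat \<Rightarrow> bool" where
  "computes_within M w v t \<longleftrightarrow>
     (let c = (step M ^^ t) (init_config M w) in fst c = halt_state M \<and> has_output c v)"


section \<open>Decision problems and polynomial-time reductions\<close>

text \<open>
  A problem restricted to a class of inputs is modelled by its set of admissible
  instances: an algorithm for it may assume that its input encodes such an instance.
\<close>

record 'a problem =
  instances :: "'a set"
  yes :: "'a \<Rightarrow> bool"
  encoding :: "'a \<Rightarrow> bool list"

text \<open>
  Many-one reductions. A halted configuration is a fixed point of \<^const>\<open>step\<close>, so
  being halted after exactly \<open>poly p n\<close> steps means halting within that many steps.
\<close>

definition polytime_reducible :: "'a problem \<Rightarrow> 'b problem \<Rightarrow> bool" where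
  "polytime_reducible A B \<longleftrightarrow>
     (\<exists>f M (p :: nat poly). valid_tm M \<and>
        (\<forall>x\<in>instances A.
           f x \<in> instances B \<and> (yes A x \<longleftrightarrow> yes B (f x)) \<and>
           computes_within M (encoding A x) (encoding B (f x))
             (poly p (length (encoding A x)))))"


section \<open>Graph Isomorphism\<close>

text \<open>
  Input graphs have vertices \<open>0, \<dots>, n - 1\<close>; every finite graph is isomorphic to one of
  these. A graph is encoded by its number of vertices in unary, a separator, and its
  adjacency matrix row by row, so that the concatenation of two codes is uniquely decodable.
\<close>

definition input_graphs :: "nat graph set" where
  "input_graphs = {G. simple_graph G \<and> (\<exists>n. verts G = {..<n})}"

definition encode_graph :: "nat graph \<Rightarrow> bool list" where
  "encode_graph G =
     (let n = card (verts G) in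
       replicate n True @ False #
       concat (map (\<lambda>i. map (\<lambda>j. {i, j} \<in> edges G) [0..<n]) [0..<n]))"

definition graph_isomorphism :: "nat graph set \<Rightarrow> (nat graph \<times> nat graph) problem" where
  "graph_isomorphism C =
     \<lparr>instances = {(G, H). G \<in> C \<inter> input_graphs \<and> H \<in> C \<inter> input_graphs},
      yes = (\<lambda>(G, H). isomorphic G H),
      encoding = (\<lambda>(G, H). encode_graph G @ encode_graph H)\<rparr>"

definition GI_complete :: "'a problem \<Rightarrow> bool" where
  "GI_complete A \<longleftrightarrow>
     polytime_reducible A (graph_isomorphism UNIV) \<and>
     polytime_reducible (graph_isomorphism UNIV) A"

end

theory Submission
  imports Defs
begin

text \<open>
  The gadget of a graph on \<open>{..<n}\<close> has base vertices \<open>i\<close> and link vertices \<open>(i, j)\<close>,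
  completely joined to each other, and for every link \<open>(i, j)\<close> a tail and a head vertex, pendant at
  the base vertices \<open>i\<close> and \<open>j\<close> respectively; both are also joined to the link \<open>(i, j)\<close> exactly
  when \<open>ij\<close> is an edge. Every neighbourhood is a disjoint union of cliques, so there is no
  diamond. An edge contains a base or a link vertex, which dominates all link or all base vertices;
  what is left is a star forest, so there is no induced \<open>P\<^sub>2 + P\<^sub>4\<close>. For \<open>n \<ge> 2\<close> the base
  vertices are those of degree above \<open>n\<^sup>2\<close>, and two of them are adjacent in the original graph iff
  a tail at one and a head at the other have a common neighbour among the links, so the gadget
  determines the graph.

  All pairs \<open>(i, j)\<close> are kept, whether edges or not, so that a Turing machine can write
  the adjacency matrix of the gadget with nested loops over the indices, reading the input only once.
\<close>

section \<open>The gadget\<close>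

datatype gadget_vertex = Base nat | Link nat nat | Tail nat nat | Head nat nat

text \<open>The adjacency takes a relation \<open>R\<close> instead of a graph, so that the
  combinatorics below is independent of how graphs and positions are represented. No case refers to
  \<open>R\<close> except a link against its own tail or head.\<close>

fun gadget_adj :: "(nat \<Rightarrow> nat \<Rightarrow> bool) \<Rightarrow> gadget_vertex \<Rightarrow> gadget_vertex \<Rightarrow> bool" where
  "gadget_adj R (Base i) (Link a b) = True"
| "gadget_adj R (Link a b) (Base i) = True"
| "gadget_adj R (Base i) (Tail a b) = (i = a)"
| "gadget_adj R (Tail a b) (Base i) = (i = a)"
| "gadget_adj R (Base i) (Head a b) = (i = b)"
| "gadget_adj R (Head a b) (Base i) = (i = b)"
| "gadget_adj R (Link a b) (Tail c d) = (a = c \<and> b = d \<and> R a b)"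
| "gadget_adj R (Tail c d) (Link a b) = (a = c \<and> b = d \<and> R a b)"
| "gadget_adj R (Link a b) (Head c d) = (a = c \<and> b = d \<and> R a b)"
| "gadget_adj R (Head c d) (Link a b) = (a = c \<and> b = d \<and> R a b)"
| "gadget_adj R _ _ = False"

lemma gadget_adj_sym: "gadget_adj R u v \<longleftrightarrow> gadget_adj R v u"
  by (cases u; cases v) auto

lemma gadget_adj_irrefl: "\<not> gadget_adj R u u"
  by (cases u) auto

text \<open>Every edge lies in at most one triangle: triangles consist of a link
  \<open>Link i j\<close> with \<open>R i j\<close>, one of its two pendants, and the base vertex of
  that pendant. Irreflexivity excludes the link \<open>Link i i\<close>, which together with
  \<open>Base i\<close> would have both \<open>Tail i i\<close> and \<open>Head i i\<close> as
  common neighbours.\<close>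

lemma gadget_adj_no_diamond:
  assumes "\<And>i. \<not> R i i" "gadget_adj R a b" "gadget_adj R a c" "gadget_adj R a d" "gadget_adj R b c" "gadget_adj R b d" "c \<noteq> d"
  shows "gadget_adj R c d"
  using assms by (cases a; cases b; simp; cases c; simp; cases d; auto)

text \<open>The edge \<open>p q\<close> keeps all base vertices or all links off the path. In the
  remaining star forest one end of the middle edge \<open>b c\<close> is a leaf, whose only
  neighbour is the other end, so \<open>a = c\<close> or \<open>b = d\<close>.\<close>

lemma gadget_adj_no_P2_P4:
  assumes "gadget_adj R p q" "gadget_adj R a b" "gadget_adj R b c" "gadget_adj R c d" "a \<noteq> c" "b \<noteq> d"
    and "\<And>x. x \<in> {a, b, c, d} \<Longrightarrow> \<not> gadget_adj R p x \<and> \<not> gadget_adj R q x"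
  shows False
proof -
  have bc: "\<not> (\<exists>i. p = Base i \<or> q = Base i) \<or> \<not> (\<exists>i j. x = Link i j)" if "x \<in> {a,b,c,d}" for x
    using assms(7)[OF that] by auto
  have bc': "\<not> (\<exists>i j. p = Link i j \<or> q = Link i j) \<or> \<not> (\<exists>i. x = Base i)" if "x \<in> {a,b,c,d}" for x
    using assms(7)[OF that] by auto
  have pq: "(\<exists>i. p = Base i \<or> q = Base i) \<or> (\<exists>i j. p = Link i j \<or> q = Link i j)"
    using assms(1) by (cases p; cases q) auto
  then show False
  proof
    assume "\<exists>i. p = Base i \<or> q = Base i"
    with bc have "\<forall>x \<in> {a,b,c,d}. \<nexists>i j. x = Link i j" by blast
    with assms(2-6) show False by (cases b; cases c; simp; cases a; cases d; auto)
  next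
    assume "\<exists>i j. p = Link i j \<or> q = Link i j"
    with bc' have "\<forall>x \<in> {a,b,c,d}. \<nexists>i. x = Base i" by blast
    with assms(2-6) show False by (cases b; cases c; simp; cases a; cases d; auto)
  qed
qed

text \<open>This order of the vertices is the order in which the loops of the machine visit them.\<close>

definition gadget_vertices :: "nat \<Rightarrow> gadget_vertex list" where
  "gadget_vertices n = concat (map (\<lambda>i. Base i # concat (map (\<lambda>j. [Link i j, Tail i j, Head i j]) [0..<n])) [0..<n])"

fun in_range :: "nat \<Rightarrow> gadget_vertex \<Rightarrow> bool" where
  "in_range n (Base i) = (i < n)"
| "in_range n (Link i j) = (i < n \<and> j < n)"
| "in_range n (Tail i j) = (i < n \<and> j < n)"
| "in_range n (Head i j) = (i < n \<and> j < n)"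

lemma set_gadget_vertices: "set (gadget_vertices n) = Collect (in_range n)"
proof (intro set_eqI)
  fix v show "v \<in> set (gadget_vertices n) \<longleftrightarrow> v \<in> Collect (in_range n)"
    by (cases v) (auto simp: gadget_vertices_def)
qed

lemma distinct_gadget_vertices: "distinct (gadget_vertices n)"
proof -
  have inner: "distinct (concat (map (\<lambda>j. [Link i j, Tail i j, Head i j]) [0..<m]))" for i m
    by (induction m) auto
  have "distinct (concat (map (\<lambda>i. Base i # concat (map (\<lambda>j. [Link i j, Tail i j, Head i j]) [0..<n])) [0..<m]))" for m
    by (induction m) (auto simp: inner)
  then show ?thesis by (simp add: gadget_vertices_def)
qed

lemma length_gadget_vertices: "length (gadget_vertices n) = n * (1 + 3 * n)"
proof -
  have inner: "length (concat (map (\<lambda>j. [Link i j, Tail i j, Head i j]) [0..<m])) = 3 * m" for i m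
    by (induction m) auto
  have "length (concat (map (\<lambda>i. Base i # concat (map (\<lambda>j. [Link i j, Tail i j, Head i j]) [0..<n])) [0..<m]))
     = m * (1 + 3 * n)" for m
    by (induction m) (auto simp: inner)
  then show ?thesis by (simp add: gadget_vertices_def)
qed

definition adjacent :: "'a graph \<Rightarrow> 'a \<Rightarrow> 'a \<Rightarrow> bool" where
  "adjacent G u v \<longleftrightarrow> {u, v} \<in> edges G"

text \<open>Gadget vertices are replaced by their positions in \<open>gadget_vertices\<close>, since
  input graphs must have an initial segment of the naturals as vertex set.\<close>

definition gadget :: "nat graph \<Rightarrow> nat graph" where
  "gadget G = (let V = gadget_vertices (card (verts G)) in
     \<lparr>verts = {..<length V},
      edges = {{a, b} | a b. a < length V \<and> b < length V \<and> gadget_adj (adjacent G) (V ! a) (V ! b)}\<rparr>)"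

lemma verts_gadget: "verts (gadget G) = {..<length (gadget_vertices (card (verts G)))}"
  by (simp add: gadget_def Let_def)

lemma edges_gadget_iff:
  "{a, b} \<in> edges (gadget G) \<longleftrightarrow>
     a < length (gadget_vertices (card (verts G))) \<and> b < length (gadget_vertices (card (verts G))) \<and>
     gadget_adj (adjacent G) (gadget_vertices (card (verts G)) ! a) (gadget_vertices (card (verts G)) ! b)"
  by (auto simp: gadget_def Let_def doubleton_eq_iff gadget_adj_sym[of "adjacent G"])

lemma gadget_in_input_graphs: "gadget G \<in> input_graphs"
  by (auto simp: input_graphs_def simple_graph_def gadget_def Let_def card_2_iff gadget_adj_irrefl)
     (metis gadget_adj_irrefl)

text \<open>This form has no positions any more, only traversals of the vertex list, which is what
  nested loops over the indices can produce.\<close>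

lemma encode_gadget:
  "encode_graph (gadget G) =
     (let V = gadget_vertices (card (verts G)) in
       replicate (length V) True @ False # concat (map (\<lambda>u. map (gadget_adj (adjacent G) u) V) V))"
proof -
  define V where "V = gadget_vertices (card (verts G))"
  have "map (\<lambda>j. {i, j} \<in> edges (gadget G)) [0..<length V] = map (gadget_adj (adjacent G) (V ! i)) V"
    if "i < length V" for i
    using that by (intro nth_equalityI) (auto simp: edges_gadget_iff V_def)
  then have "map (\<lambda>i. map (\<lambda>j. {i, j} \<in> edges (gadget G)) [0..<length V]) [0..<length V]
      = map (\<lambda>u. map (gadget_adj (adjacent G) u) V) V"
    by (intro nth_equalityI) auto
  then show ?thesis
    by (simp add: encode_graph_def Let_def verts_gadget V_def[symmetric])
qed

section \<open>Absence of the two induced subgraphs\<close>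

lemma induced_isomorphic_embed:
  assumes "isomorphic (induced G S) H"
  obtains g where "inj_on g (verts H)" "g ` verts H = S"
    "\<And>u v. u \<in> verts H \<Longrightarrow> v \<in> verts H \<Longrightarrow> {g u, g v} \<in> edges G \<longleftrightarrow> {u, v} \<in> edges H"
proof -
  obtain f where f: "bij_betw f S (verts H)"
    "\<And>u v. u \<in> S \<Longrightarrow> v \<in> S \<Longrightarrow> {u, v} \<in> edges G \<longleftrightarrow> {f u, f v} \<in> edges H"
    using assms by (auto simp: isomorphic_def induced_def)
  \<comment> \<open>The given isomorphism goes from the induced subgraph to the pattern; its inverse
    lets the vertices of the copy be named by those of the pattern.\<close>
  let ?g = "inv_into S f"
  have g: "bij_betw ?g (verts H) S"
    using f(1) by (rule bij_betw_inv_into)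
  show ?thesis
  proof
    show "inj_on ?g (verts H)" "?g ` verts H = S"
      using g by (auto simp: bij_betw_def)
    fix u v assume uv: "u \<in> verts H" "v \<in> verts H"
    then have "?g u \<in> S" "?g v \<in> S" "f (?g u) = u" "f (?g v) = v"
      using g f(1) by (auto simp: bij_betw_apply bij_betw_inv_into_right)
    with f(2) show "{?g u, ?g v} \<in> edges G \<longleftrightarrow> {u, v} \<in> edges H"
      by metis
  qed
qed

lemma gadget_free_of_diamond:
  assumes "simple_graph G"
  shows "free_of (complement (disjoint_union (copies 2 (path_graph 1)) (path_graph 2))) (gadget G)"
    (is "free_of ?D _")
  unfolding free_of_def
proof (intro notI, elim exE conjE)
  fix S assume "S \<subseteq> verts (gadget G)" "isomorphic (induced (gadget G) S) ?D"
  then obtain g where g: "inj_on g (verts ?D)" "g ` verts ?D \<subseteq> verts (gadget G)"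
    "\<And>u v. u \<in> verts ?D \<Longrightarrow> v \<in> verts ?D \<Longrightarrow> {g u, g v} \<in> edges (gadget G) \<longleftrightarrow> {u, v} \<in> edges ?D"
    by (metis induced_isomorphic_embed)
  define V where "V = gadget_vertices (card (verts G))"
  \<comment> \<open>Complementation makes the two isolated vertices \<open>a\<close> and
    \<open>b\<close> adjacent to everything, while the ends \<open>c\<close> and \<open>d\<close> of
    the single edge become the only non-adjacent pair.\<close>
  define c d a b :: "nat \<times> nat + nat"
    where "c = Inr 0" and "d = Inr 1" and "a = Inl (0, 0)" and "b = Inl (1, 0)"
  note defs = a_def b_def c_def d_def
  have verts: "verts ?D = {a, b, c, d}"
    by (auto simp: complement_def disjoint_union_def copies_def path_graph_def defs less_2_cases_iff)
  have not_edge: "{c, d} \<notin> edges ?D"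
    by (auto simp: complement_def disjoint_union_def path_graph_def defs image_iff)
  have edge: "{a, b} \<in> edges ?D" "{a, c} \<in> edges ?D" "{a, d} \<in> edges ?D" "{b, c} \<in> edges ?D" "{b, d} \<in> edges ?D"
    by (auto simp: complement_def disjoint_union_def copies_def path_graph_def defs image_iff
        doubleton_eq_iff less_2_cases_iff)
  have irr: "\<not> adjacent G i i" for i
    using assms by (auto simp: simple_graph_def adjacent_def)
  have e: "{g u, g v} \<in> edges (gadget G) \<longleftrightarrow> gadget_adj (adjacent G) (V ! g u) (V ! g v)"
    if "u \<in> {a, b, c, d}" "v \<in> {a, b, c, d}" for u v
    using that g(2) unfolding verts by (auto simp: edges_gadget_iff V_def verts_gadget)
  have cd: "c \<noteq> d" by (simp add: defs)
  then have "g c \<noteq> g d" using g(1) unfolding verts by (auto simp: inj_on_def)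
  moreover have "g c < length V" "g d < length V"
    using g(2) unfolding verts by (auto simp: V_def verts_gadget)
  ultimately have "V ! g c \<noteq> V ! g d"
    by (simp add: V_def nth_eq_iff_index_eq distinct_gadget_vertices)
  moreover have "\<not> gadget_adj (adjacent G) (V ! g c) (V ! g d)"
    using g(3)[of c d, unfolded verts] e[of c d] not_edge by simp
  moreover have "gadget_adj (adjacent G) (V ! g u) (V ! g v)" if "{u, v} \<in> edges ?D"
    "u \<in> {a, b, c, d}" "v \<in> {a, b, c, d}" for u v
    using g(3)[of u v, unfolded verts] e[of u v] that by simp
  ultimately show False
    using gadget_adj_no_diamond[of "adjacent G" "V ! g a" "V ! g b" "V ! g c" "V ! g d"] irr edge by auto
qed

lemma edges_disjoint_union:
  "{Inl i, Inl j} \<in> edges (disjoint_union A B) \<longleftrightarrow> {i, j} \<in> edges A"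
  "{Inr k, Inr m} \<in> edges (disjoint_union A B) \<longleftrightarrow> {k, m} \<in> edges B"
  "{Inl i, Inr k} \<notin> edges (disjoint_union A B)"
proof -
  have inj: "inj ((`) (Inl :: 'a \<Rightarrow> 'a + 'b))" "inj ((`) (Inr :: 'b \<Rightarrow> 'a + 'b))"
    by (auto simp: inj_def inj_image_eq_iff)
  have "Inl i \<notin> Inr ` e" "Inr k \<notin> Inl ` e'" for e :: "'b set" and e' :: "'a set"
    by auto
  then have ne: "{Inl i, x} \<noteq> Inr ` e" "{x, Inr k} \<noteq> Inl ` e'" for x e e'
    by blast+
  then show "{Inl i, Inr k} \<notin> edges (disjoint_union A B)"
    by (auto simp: disjoint_union_def)
  show "{Inl i, Inl j} \<in> edges (disjoint_union A B) \<longleftrightarrow> {i, j} \<in> edges A"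
    using inj_image_mem_iff[OF inj(1), of "{i, j}" "edges A"] ne(1)[of "Inl j"]
    by (auto simp: disjoint_union_def simp del: inj_image_mem_iff)
  show "{Inr k, Inr m} \<in> edges (disjoint_union A B) \<longleftrightarrow> {k, m} \<in> edges B"
    using inj_image_mem_iff[OF inj(2), of "{k, m}" "edges B"] ne(2)[of "Inr m"]
    by (auto simp: disjoint_union_def insert_commute simp del: inj_image_mem_iff)
qed

lemma gadget_free_of_P2_P4:
  shows "free_of (disjoint_union (path_graph 2) (path_graph 4)) (gadget G)"
    (is "free_of ?D _")
  unfolding free_of_def
proof (intro notI, elim exE conjE)
  fix S assume "S \<subseteq> verts (gadget G)" "isomorphic (induced (gadget G) S) ?D"
  then obtain g where g: "inj_on g (verts ?D)" "g ` verts ?D \<subseteq> verts (gadget G)"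
    "\<And>u v. u \<in> verts ?D \<Longrightarrow> v \<in> verts ?D \<Longrightarrow> {g u, g v} \<in> edges (gadget G) \<longleftrightarrow> {u, v} \<in> edges ?D"
    by (metis induced_isomorphic_embed)
  define V where "V = gadget_vertices (card (verts G))"
  have ipath: "i < r \<Longrightarrow> j < r \<Longrightarrow> {i, j} \<in> edges (path_graph r) \<longleftrightarrow> j = Suc i \<or> i = Suc j" for i j r
    by (auto simp: path_graph_def doubleton_eq_iff)
  have e: "gadget_adj (adjacent G) (V ! g u) (V ! g v) \<longleftrightarrow> {u, v} \<in> edges ?D"
    if "u \<in> verts ?D" "v \<in> verts ?D" for u v
    using that g(2) g(3)[OF that] by (auto simp: edges_gadget_iff V_def verts_gadget)
  have ne: "V ! g u \<noteq> V ! g v" if "u \<in> verts ?D" "v \<in> verts ?D" "u \<noteq> v" for u v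
  proof -
    have "g u \<noteq> g v" using g(1) that by (auto simp: inj_on_def)
    moreover have "g u < length V" "g v < length V"
      using g(2) that by (auto simp: V_def verts_gadget)
    ultimately show ?thesis
      by (simp add: V_def nth_eq_iff_index_eq distinct_gadget_vertices)
  qed
  define L R where "L i = V ! g (Inl i)" and "R i = V ! g (Inr i)" for i
  have mem: "i < 2 \<Longrightarrow> Inl i \<in> verts ?D" "i < 4 \<Longrightarrow> Inr i \<in> verts ?D" for i
    by (simp_all add: disjoint_union_def path_graph_def)
  have LL: "gadget_adj (adjacent G) (L 0) (L 1)"
    using e[OF mem(1) mem(1), of 0 1] by (simp add: L_def edges_disjoint_union ipath)
  have RR: "gadget_adj (adjacent G) (R i) (R j) \<longleftrightarrow> j = Suc i \<or> i = Suc j" if "i < 4" "j < 4" for i j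
    using e[OF mem(2)[OF that(1)] mem(2)[OF that(2)]] that
    by (simp add: R_def edges_disjoint_union ipath)
  have LR: "\<not> gadget_adj (adjacent G) (L i) (R j)" if "i < 2" "j < 4" for i j
    using e[OF mem(1)[OF that(1)] mem(2)[OF that(2)]]
    by (simp add: L_def R_def edges_disjoint_union)
  have ne: "R i \<noteq> R j" if "i < 4" "j < 4" "i \<noteq> j" for i j
    using ne[OF mem(2)[OF that(1)] mem(2)[OF that(2)]] that(3) by (simp add: R_def)
  show False
  proof (rule gadget_adj_no_P2_P4[OF LL])
    show "gadget_adj (adjacent G) (R 0) (R 1)" "gadget_adj (adjacent G) (R 1) (R 2)" "gadget_adj (adjacent G) (R 2) (R 3)"
      by (simp_all add: RR)
    show "R 0 \<noteq> R 2" "R 1 \<noteq> R 3"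
      by (simp_all add: ne)
    show "\<not> gadget_adj (adjacent G) (L 0) x \<and> \<not> gadget_adj (adjacent G) (L 1) x" if "x \<in> {R 0, R 1, R 2, R 3}" for x
      using that LR by auto
  qed
qed

section \<open>Recovering a graph from its gadget\<close>

definition gadget_iso :: "nat \<Rightarrow> (nat \<Rightarrow> nat \<Rightarrow> bool) \<Rightarrow> (nat \<Rightarrow> nat \<Rightarrow> bool) \<Rightarrow> (gadget_vertex \<Rightarrow> gadget_vertex) \<Rightarrow> bool" where
  "gadget_iso n R R' \<phi> \<longleftrightarrow> bij_betw \<phi> (Collect (in_range n)) (Collect (in_range n)) \<and>
     (\<forall>u v. in_range n u \<longrightarrow> in_range n v \<longrightarrow> gadget_adj R u v = gadget_adj R' (\<phi> u) (\<phi> v))"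

lemma gadget_iso_inverse:
  assumes "gadget_iso n R R' \<phi>"
  shows "gadget_iso n R' R (inv_into (Collect (in_range n)) \<phi>)"
proof -
  let ?A = "Collect (in_range n)"
  have bij: "bij_betw \<phi> ?A ?A"
    using assms by (simp add: gadget_iso_def)
  have inv: "bij_betw (inv_into ?A \<phi>) ?A ?A"
    using bij by (rule bij_betw_inv_into)
  have "in_range n (inv_into ?A \<phi> u)" "\<phi> (inv_into ?A \<phi> u) = u" if "in_range n u" for u
    using bij_betw_apply[OF inv, of u] bij_betw_inv_into_right[OF bij, of u] that by auto
  then show ?thesis
    using assms inv unfolding gadget_iso_def by auto
qed

lemma finite_in_range: "finite (Collect (in_range n))"
  by (simp flip: set_gadget_vertices)

text \<open>A base vertex sees all \<open>n * n\<close> links. The tail \<open>Tail i 0\<close>,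
  which is in range because \<open>i < n\<close> forces \<open>0 < n\<close>, makes the inequality
  strict.\<close>

lemma card_nbrs_Base:
  assumes "i < n"
  shows "n * n < card {u. in_range n u \<and> gadget_adj R (Base i) u}"
proof -
  have "n * n = card ((\<lambda>(a, b). Link a b) ` ({..<n} \<times> {..<n}))"
    by (subst card_image) (auto simp: inj_on_def)
  also have "\<dots> < card (insert (Tail i 0) ((\<lambda>(a, b). Link a b) ` ({..<n} \<times> {..<n})))"
    by (subst card_insert_disjoint) auto
  also have "\<dots> \<le> card {u. in_range n u \<and> gadget_adj R (Base i) u}"
    using assms by (intro card_mono finite_subset[OF _ finite_in_range[of n]]) auto
  finally show ?thesis .
qed

text \<open>A link sees at most the \<open>n\<close> base vertices and its own two pendants; a tail
  or a head sees at most one base vertex and one link.\<close>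

lemma card_nbrs_not_Base:
  assumes "\<And>i. v \<noteq> Base i"
  shows "card {u. in_range n u \<and> gadget_adj R v u} \<le> n + 2"
proof -
  have two: "card {x, y} \<le> n + 2" for x y :: gadget_vertex
    by (rule order.trans[OF card_insert_le_m1]) auto
  show ?thesis
  proof (cases v)
    case (Link a b)
    have "{u. in_range n u \<and> gadget_adj R v u} \<subseteq> Base ` {..<n} \<union> {Tail a b, Head a b}"
    proof
      fix u assume "u \<in> {u. in_range n u \<and> gadget_adj R v u}"
      with Link show "u \<in> Base ` {..<n} \<union> {Tail a b, Head a b}"
        by (cases u) auto
    qed
    then have "card {u. in_range n u \<and> gadget_adj R v u} \<le> card (Base ` {..<n} \<union> {Tail a b, Head a b})"
      by (intro card_mono) auto
    also have "\<dots> \<le> card (Base ` {..<n}) + card {Tail a b, Head a b}"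
      by (rule card_Un_le)
    also have "\<dots> = n + 2"
      by (simp add: card_image inj_on_def)
    finally show ?thesis .
  next
    case (Tail a b)
    have "{u. in_range n u \<and> gadget_adj R v u} \<subseteq> {Base a, Link a b}"
    proof
      fix u assume "u \<in> {u. in_range n u \<and> gadget_adj R v u}"
      with Tail show "u \<in> {Base a, Link a b}"
        by (cases u) auto
    qed
    then show ?thesis
      by (meson card_mono finite.emptyI finite.insertI order.trans two)
  next
    case (Head a b)
    have "{u. in_range n u \<and> gadget_adj R v u} \<subseteq> {Base b, Link a b}"
    proof
      fix u assume "u \<in> {u. in_range n u \<and> gadget_adj R v u}"
      with Head show "u \<in> {Base b, Link a b}"
        by (cases u) auto
    qed
    then show ?thesis
      by (meson card_mono finite.emptyI finite.insertI order.trans two)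
  qed (use assms in auto)
qed

lemma gadget_iso_card_nbrs:
  assumes "gadget_iso n R R' \<phi>" "in_range n v"
  shows "card {u. in_range n u \<and> gadget_adj R' (\<phi> v) u} = card {u. in_range n u \<and> gadget_adj R v u}"
proof -
  have bij: "bij_betw \<phi> (Collect (in_range n)) (Collect (in_range n))"
    and adj: "\<And>u. in_range n u \<Longrightarrow> gadget_adj R v u = gadget_adj R' (\<phi> v) (\<phi> u)"
    using assms by (auto simp: gadget_iso_def)
  have "{u. in_range n u \<and> gadget_adj R' (\<phi> v) u} = \<phi> ` {u. in_range n u \<and> gadget_adj R v u}"
  proof (intro equalityI subsetI)
    fix w assume w: "w \<in> {u. in_range n u \<and> gadget_adj R' (\<phi> v) u}"
    then have "w \<in> \<phi> ` Collect (in_range n)"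
      using bij by (simp add: bij_betw_def)
    with w adj show "w \<in> \<phi> ` {u. in_range n u \<and> gadget_adj R v u}"
      by auto
  next
    fix w assume "w \<in> \<phi> ` {u. in_range n u \<and> gadget_adj R v u}"
    then show "w \<in> {u. in_range n u \<and> gadget_adj R' (\<phi> v) u}"
      using adj bij_betw_apply[OF bij] by auto
  qed
  moreover have "inj_on \<phi> {u. in_range n u \<and> gadget_adj R v u}"
    using bij by (auto simp: bij_betw_def intro: inj_on_subset)
  ultimately show ?thesis
    by (simp add: card_image)
qed

lemma gadget_iso_Base_iff:
  assumes "gadget_iso n R R' \<phi>" "in_range n v" "2 \<le> n"
  shows "(\<exists>i. \<phi> v = Base i) \<longleftrightarrow> (\<exists>i. v = Base i)"
proof -
  have Base_iff: "(\<exists>i. u = Base i) \<longleftrightarrow> n * n < card {w. in_range n w \<and> gadget_adj Q u w}"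
    if "in_range n u" for u Q
  proof -
    \<comment> \<open>The thresholds \<open>n + 2\<close> and \<open>n * n\<close> are compatible
      from \<open>n = 2\<close> on. There they coincide, so the strictness of
      \<open>card_nbrs_Base\<close> is essential.\<close>
    have "2 * n \<le> n * n" using \<open>2 \<le> n\<close> by simp
    then have "n + 2 \<le> n * n" using \<open>2 \<le> n\<close> by linarith
    then show ?thesis
      using that card_nbrs_Base[of _ n Q] card_nbrs_not_Base[of u n Q]
      by (metis in_range.simps(1) leD order.trans)
  qed
  have "in_range n (\<phi> v)"
    using assms(1,2) bij_betw_apply[of \<phi> "Collect (in_range n)" "Collect (in_range n)" v]
    by (simp add: gadget_iso_def)
  then show ?thesis
    using Base_iff[of "\<phi> v" R'] Base_iff[of v R] gadget_iso_card_nbrs[OF assms(1,2)] assms(2) by simp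
qed

text \<open>The images \<open>y\<close>, \<open>f\<close>, \<open>f'\<close> of the link and its
  pendants are not base vertices, and \<open>y\<close> is adjacent to both \<open>f\<close> and
  \<open>f'\<close>. A tail or head has only one neighbour outside the base, so
  \<open>f \<noteq> f'\<close> makes \<open>y\<close> a link \<open>Link c d\<close> with
  \<open>R' c d\<close>, and \<open>f\<close>, \<open>f'\<close> are its tail and head in some
  order. Their base neighbours are then \<open>c\<close> and \<open>d\<close>; as the order may be
  reversed, symmetry of \<open>R'\<close> is required.\<close>

lemma gadget_iso_edge:
  assumes iso: "gadget_iso n R R' \<phi>" and n: "2 \<le> n" "i < n" "j < n"
    and "R i j" and sym: "\<And>a b. R' a b \<Longrightarrow> R' b a"
    and \<phi>: "\<phi> (Base i) = Base a" "\<phi> (Base j) = Base b"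
  shows "R' a b"
proof -
  define y f f' where "y = \<phi> (Link i j)" and "f = \<phi> (Tail i j)" and "f' = \<phi> (Head i j)"
  have not_Base: "\<nexists>k. y = Base k" "\<nexists>k. f = Base k" "\<nexists>k. f' = Base k"
    using gadget_iso_Base_iff[OF iso _ n(1), of "Link i j"] gadget_iso_Base_iff[OF iso _ n(1), of "Tail i j"]
      gadget_iso_Base_iff[OF iso _ n(1), of "Head i j"] n by (auto simp: y_def f_def f'_def)
  have adj: "gadget_adj R' (\<phi> u) (\<phi> v)" if "gadget_adj R u v" "in_range n u" "in_range n v" for u v
    using iso that by (simp add: gadget_iso_def)
  have "gadget_adj R' y f" "gadget_adj R' y f'" "gadget_adj R' (Base a) f" "gadget_adj R' (Base b) f'"
    using adj[of "Link i j" "Tail i j"] adj[of "Link i j" "Head i j"]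
      adj[of "Base i" "Tail i j"] adj[of "Base j" "Head i j"] n \<open>R i j\<close> \<phi>
    by (auto simp: y_def f_def f'_def)
  moreover have "f \<noteq> f'"
    using iso n inj_onD[of \<phi> "Collect (in_range n)" "Tail i j" "Head i j"]
    by (auto simp: gadget_iso_def bij_betw_def f_def f'_def)
  ultimately have "R' a b \<or> R' b a"
    using not_Base by (cases y; cases f; cases f') auto
  then show ?thesis
    using sym by blast
qed

lemma gadget_iso_imp_bij:
  assumes iso: "gadget_iso n R R' \<phi>" and n: "2 \<le> n"
    and sym: "\<And>a b. R a b \<Longrightarrow> R b a" "\<And>a b. R' a b \<Longrightarrow> R' b a"
  obtains \<pi> where "bij_betw \<pi> {..<n} {..<n}" "\<And>i j. i < n \<Longrightarrow> j < n \<Longrightarrow> R i j \<longleftrightarrow> R' (\<pi> i) (\<pi> j)"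
proof -
  let ?A = "Collect (in_range n)"
  have bij: "bij_betw \<phi> ?A ?A"
    using iso by (simp add: gadget_iso_def)
  have "\<exists>j. \<phi> (Base i) = Base j" if "i < n" for i
    using gadget_iso_Base_iff[OF iso _ n, of "Base i"] that by auto
  then obtain \<pi> where \<pi>: "\<And>i. i < n \<Longrightarrow> \<phi> (Base i) = Base (\<pi> i)"
    by metis
  have range: "\<pi> i < n" if "i < n" for i
    using bij_betw_apply[OF bij, of "Base i"] \<pi>[OF that] that by simp
  have "inj_on \<pi> {..<n}"
    using bij \<pi> unfolding bij_betw_def inj_on_def
    by (metis gadget_vertex.inject(1) in_range.simps(1) lessThan_iff mem_Collect_eq)
  then have "bij_betw \<pi> {..<n} {..<n}"
    using range by (simp add: bij_betw_def endo_inj_surj image_subset_iff)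
  moreover have "R i j \<longleftrightarrow> R' (\<pi> i) (\<pi> j)" if ij: "i < n" "j < n" for i j
  proof
    show "R i j \<Longrightarrow> R' (\<pi> i) (\<pi> j)"
      using gadget_iso_edge[OF iso n ij _ sym(2) \<pi>[OF ij(1)] \<pi>[OF ij(2)]] by simp
    \<comment> \<open>The converse is the same implication for the inverse isomorphism, which sends
      \<open>Base (\<pi> k)\<close> back to \<open>Base k\<close>.\<close>
    have "inv_into ?A \<phi> (Base (\<pi> k)) = Base k" if "k < n" for k
      using bij_betw_inv_into_left[OF bij, of "Base k"] \<pi>[OF that] that by simp
    then show "R' (\<pi> i) (\<pi> j) \<Longrightarrow> R i j"
      using gadget_iso_edge[OF gadget_iso_inverse[OF iso] n range[OF ij(1)] range[OF ij(2)] _ sym(1)] ij by simp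
  qed
  ultimately show thesis by (rule that)
qed

fun gadget_map :: "(nat \<Rightarrow> nat) \<Rightarrow> gadget_vertex \<Rightarrow> gadget_vertex" where
  "gadget_map \<pi> (Base i) = Base (\<pi> i)"
| "gadget_map \<pi> (Link i j) = Link (\<pi> i) (\<pi> j)"
| "gadget_map \<pi> (Tail i j) = Tail (\<pi> i) (\<pi> j)"
| "gadget_map \<pi> (Head i j) = Head (\<pi> i) (\<pi> j)"

lemma gadget_iso_gadget_map:
  assumes bij: "bij_betw \<pi> {..<n} {..<n}"
    and R: "\<And>i j. i < n \<Longrightarrow> j < n \<Longrightarrow> R i j \<longleftrightarrow> R' (\<pi> i) (\<pi> j)"
  shows "gadget_iso n R R' (gadget_map \<pi>)"
proof -
  have range: "\<pi> i < n" if "i < n" for i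
    using bij_betw_apply[OF bij, of i] that by simp
  have inj: "\<pi> i = \<pi> j \<longleftrightarrow> i = j" if "i < n" "j < n" for i j
    using bij that by (auto simp: bij_betw_def inj_on_def)
  have "inj_on (gadget_map \<pi>) (Collect (in_range n))"
  proof (rule inj_onI)
    fix u v assume "u \<in> Collect (in_range n)" "v \<in> Collect (in_range n)" "gadget_map \<pi> u = gadget_map \<pi> v"
    then show "u = v" by (cases u; cases v) (auto simp: inj)
  qed
  moreover have "in_range n (gadget_map \<pi> u)" if "in_range n u" for u
    using that by (cases u) (auto simp: range)
  ultimately have "bij_betw (gadget_map \<pi>) (Collect (in_range n)) (Collect (in_range n))"
    using endo_inj_surj[OF finite_in_range[of n], of "gadget_map \<pi>"]
    by (simp add: bij_betw_def image_subset_iff)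
  moreover have "gadget_adj R u v = gadget_adj R' (gadget_map \<pi> u) (gadget_map \<pi> v)" if "in_range n u" "in_range n v" for u v
    using that by (cases u; cases v) (auto simp: inj R)
  ultimately show ?thesis
    by (simp add: gadget_iso_def)
qed

text \<open>Conjugation with the enumeration \<open>(!) V\<close>, a bijection from positions onto
  gadget vertices, translates between isomorphisms of the numbered gadgets and
  \<open>gadget_iso\<close>.\<close>

lemma isomorphic_gadget_iff_gadget_iso:
  assumes "card (verts G) = n" "card (verts H) = n"
  shows "isomorphic (gadget G) (gadget H) \<longleftrightarrow> (\<exists>\<phi>. gadget_iso n (adjacent G) (adjacent H) \<phi>)"
proof -
  define V N where "V = gadget_vertices n" and "N = length V"
  let ?A = "Collect (in_range n)"
  let ?index = "inv_into {..<N} ((!) V)"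
  have nth: "bij_betw ((!) V) {..<N} ?A"
    by (rule bij_betw_nth) (auto simp: V_def N_def distinct_gadget_vertices set_gadget_vertices)
  have index: "bij_betw ?index ?A {..<N}"
    using nth by (rule bij_betw_inv_into)
  have nth_index: "V ! ?index u = u" "?index u < N" if "in_range n u" for u
    using bij_betw_inv_into_right[OF nth, of u] bij_betw_apply[OF index, of u] that by auto
  have in_range_nth: "in_range n (V ! a)" if "a < N" for a
    using bij_betw_apply[OF nth, of a] that by simp
  have edge: "{a, b} \<in> edges (gadget K) \<longleftrightarrow> gadget_adj (adjacent K) (V ! a) (V ! b)"
    if "card (verts K) = n" "a < N" "b < N" for K a b
    using that by (simp add: edges_gadget_iff V_def N_def)
  have verts: "verts (gadget G) = {..<N}" "verts (gadget H) = {..<N}"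
    using assms by (simp_all add: verts_gadget V_def N_def)
  show ?thesis
  proof
    assume "isomorphic (gadget G) (gadget H)"
    then obtain f where f: "bij_betw f {..<N} {..<N}"
      "\<And>a b. a < N \<Longrightarrow> b < N \<Longrightarrow> {a, b} \<in> edges (gadget G) \<longleftrightarrow> {f a, f b} \<in> edges (gadget H)"
      by (auto simp: isomorphic_def verts)
    have "f a < N" if "a < N" for a
      using bij_betw_apply[OF f(1), of a] that by simp
    then have "gadget_adj (adjacent G) u v = gadget_adj (adjacent H) (V ! f (?index u)) (V ! f (?index v))"
      if "in_range n u" "in_range n v" for u v
      using f(2)[of "?index u" "?index v"] that by (simp add: edge assms nth_index)
    moreover have "bij_betw ((!) V \<circ> (f \<circ> ?index)) ?A ?A"
      using index f(1) nth by (intro bij_betw_trans)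
    ultimately have "gadget_iso n (adjacent G) (adjacent H) ((!) V \<circ> (f \<circ> ?index))"
      by (simp add: gadget_iso_def)
    then show "\<exists>\<phi>. gadget_iso n (adjacent G) (adjacent H) \<phi>"
      by (intro exI[where x = "(!) V \<circ> (f \<circ> ?index)"])
  next
    assume "\<exists>\<phi>. gadget_iso n (adjacent G) (adjacent H) \<phi>"
    then obtain \<phi> where \<phi>: "bij_betw \<phi> ?A ?A"
      "\<And>u v. in_range n u \<Longrightarrow> in_range n v \<Longrightarrow>
        gadget_adj (adjacent G) u v = gadget_adj (adjacent H) (\<phi> u) (\<phi> v)"
      by (auto simp: gadget_iso_def)
    have "in_range n (\<phi> u)" if "in_range n u" for u
      using bij_betw_apply[OF \<phi>(1), of u] that by simp
    then have "{a, b} \<in> edges (gadget G) \<longleftrightarrow>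
        {?index (\<phi> (V ! a)), ?index (\<phi> (V ! b))} \<in> edges (gadget H)" if "a < N" "b < N" for a b
      using \<phi>(2)[of "V ! a" "V ! b"] that by (simp add: edge assms nth_index in_range_nth)
    moreover have "bij_betw (?index \<circ> (\<phi> \<circ> (!) V)) {..<N} {..<N}"
      using index \<phi>(1) nth by (intro bij_betw_trans)
    ultimately show "isomorphic (gadget G) (gadget H)"
      unfolding isomorphic_def verts by (intro exI[of _ "?index \<circ> (\<phi> \<circ> (!) V)"]) auto
  qed
qed

lemma isomorphic_gadget_iff:
  assumes "G \<in> input_graphs" "H \<in> input_graphs"
  shows "isomorphic (gadget G) (gadget H) \<longleftrightarrow> isomorphic G H"
proof -
  obtain n m where verts: "verts G = {..<n}" "verts H = {..<m}"
    using assms by (auto simp: input_graphs_def)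
  have iso_iff: "isomorphic G H \<longleftrightarrow> (\<exists>\<pi>. bij_betw \<pi> {..<n} {..<m} \<and>
      (\<forall>i<n. \<forall>j<n. adjacent G i j \<longleftrightarrow> adjacent H (\<pi> i) (\<pi> j)))"
    by (auto simp: isomorphic_def verts adjacent_def)
  have irrefl: "\<not> adjacent K i i" if "K \<in> input_graphs" for K i
    using that by (auto simp: input_graphs_def simple_graph_def adjacent_def)
  have sym: "adjacent K i j \<Longrightarrow> adjacent K j i" for K :: "nat graph" and i j
    by (simp add: adjacent_def insert_commute)
  have "isomorphic (gadget G) (gadget H) \<Longrightarrow> n = m"
  proof -
    assume "isomorphic (gadget G) (gadget H)"
    then have "n * (1 + 3 * n) = m * (1 + 3 * m)"
      by (auto simp: isomorphic_def verts_gadget verts length_gadget_vertices dest: bij_betw_same_card)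
    \<comment> \<open>The number of vertices of a gadget is strictly increasing in \<open>n\<close>,
      so isomorphic gadgets come from graphs of equal order.\<close>
    moreover have "x * (1 + 3 * x) < y * (1 + 3 * y)" if "x < y" for x y :: nat
      using that by (intro mult_strict_mono) auto
    ultimately show "n = m"
      by (metis less_irrefl linorder_neqE_nat)
  qed
  moreover have "isomorphic G H \<Longrightarrow> n = m"
    by (auto simp: iso_iff dest: bij_betw_same_card)
  moreover have "isomorphic (gadget G) (gadget H) \<longleftrightarrow> isomorphic G H" if [simp]: "n = m"
  proof -
    have iff: "isomorphic (gadget G) (gadget H) \<longleftrightarrow> (\<exists>\<phi>. gadget_iso n (adjacent G) (adjacent H) \<phi>)"
      by (rule isomorphic_gadget_iff_gadget_iso) (simp_all add: verts)
    show ?thesis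
    proof
      assume "isomorphic G H"
      then show "isomorphic (gadget G) (gadget H)"
        unfolding iff iso_iff using gadget_iso_gadget_map[of _ n "adjacent G" "adjacent H"] by auto
    next
      assume "isomorphic (gadget G) (gadget H)"
      then obtain \<phi> where \<phi>: "gadget_iso n (adjacent G) (adjacent H) \<phi>"
        using iff by blast
      show "isomorphic G H"
      proof (cases "2 \<le> n")
        case True
        show ?thesis
          by (rule gadget_iso_imp_bij[OF \<phi> True sym sym]) (auto simp: iso_iff)
      next
        case False
        then have "i < n \<Longrightarrow> j < n \<Longrightarrow> i = j" for i j by linarith
        then have "bij_betw id {..<n} {..<n} \<and> (\<forall>i<n. \<forall>j<n. adjacent G i j \<longleftrightarrow> adjacent H (id i) (id j))"
          using irrefl assms by (metis bij_betw_id id_apply)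
        then show ?thesis
          unfolding iso_iff by auto
      qed
    qed
  qed
  ultimately show ?thesis by blast
qed

section \<open>Structured Turing machine programs\<close>

text \<open>
  A program consists of its number of states \<open>n\<close> and a transition function on the states below
  \<open>n\<close>. It is entered in state 0 and left in state \<open>n\<close>, so that in \<open>A ;; B\<close> the exit of \<open>A\<close> is the
  entry of \<open>B\<close>.
\<close>

type_synonym prog = "nat \<times> (nat \<Rightarrow> nat list \<Rightarrow> nat \<times> (nat \<times> move) list)"

definition pstep :: "prog \<Rightarrow> config \<Rightarrow> config" where
  "pstep A c = (let (q, as) = snd A (fst c) (map scanned (snd c)) in (q, map2 act as (snd c)))"

text \<open>Every step starts in a proper state of \<open>A\<close>. A run therefore never continues
  from the exit state, and stays a run when \<open>A\<close> is embedded in a larger program that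
  gives this state a new meaning.\<close>

inductive reach :: "prog \<Rightarrow> config \<Rightarrow> nat \<Rightarrow> config \<Rightarrow> bool" for A where
  refl: "reach A c 0 c"
| step: "fst c < fst A \<Longrightarrow> reach A (pstep A c) t c' \<Longrightarrow> reach A c (Suc t) c'"

definition runs :: "prog \<Rightarrow> tape list \<Rightarrow> nat \<Rightarrow> tape list \<Rightarrow> bool" where
  "runs A T b T' \<longleftrightarrow> (\<exists>t\<le>b. reach A (0, T) t (fst A, T'))"

definition Do :: "(nat list \<Rightarrow> (nat \<times> move) list) \<Rightarrow> prog" where
  "Do f = (1, \<lambda>q s. (1, f s))"

definition Seq :: "prog \<Rightarrow> prog \<Rightarrow> prog" (infixr ";;" 60) where
  "Seq A B = (fst A + fst B, \<lambda>q s. if q < fst A then snd A q s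
     else apfst ((+) (fst A)) (snd B (q - fst A) s))"

text \<open>State 0 is the test, which leaves the tapes unchanged. The states of the body are
  shifted by one, and its exit is redirected to the test.\<close>

definition While :: "(nat list \<Rightarrow> bool) \<Rightarrow> prog \<Rightarrow> prog" where
  "While P A = (Suc (fst A), \<lambda>q s.
     if q = 0 then (if P s then 1 else Suc (fst A), map (\<lambda>a. (a, Stay)) s)
     else apfst (\<lambda>q'. if q' = fst A then 0 else Suc q') (snd A (q - 1) s))"

lemma reach_trans: "reach A c s c' \<Longrightarrow> reach A c' t c'' \<Longrightarrow> reach A c (s + t) c''"
  by (induction rule: reach.induct) (auto intro: reach.step)

text \<open>Common core of sequencing and looping: a renaming of states that respects transitions
  carries runs over. Only proper states must go to proper states; the exit of \<open>A\<close> may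
  be sent anywhere.\<close>

lemma reach_embed:
  assumes "reach A c t c'"
    and "\<And>q. q < fst A \<Longrightarrow> \<phi> q < fst B"
    and "\<And>q s. q < fst A \<Longrightarrow> snd B (\<phi> q) s = apfst \<phi> (snd A q s)"
  shows "reach B (apfst \<phi> c) t (apfst \<phi> c')"
  using assms(1)
proof (induction rule: reach.induct)
  case (refl c)
  show ?case by (rule reach.refl)
next
  case (step c t c')
  have "pstep B (apfst \<phi> c) = apfst \<phi> (pstep A c)"
    using assms(3)[OF step.hyps(1)] by (auto simp: pstep_def split: prod.splits)
  with step show ?case
    by (intro reach.step) (auto simp: assms(2))
qed

lemma runs_mono: "runs A T b T' \<Longrightarrow> b \<le> b' \<Longrightarrow> runs A T b' T'"
  unfolding runs_def by (meson order.trans)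

lemma runs_Do: "map2 act (f (map scanned T)) T = T' \<Longrightarrow> runs (Do f) T 1 T'"
  unfolding runs_def
  by (intro exI[of _ 1] conjI order.refl, unfold One_nat_def, rule reach.step)
     (auto simp: Do_def pstep_def intro: reach.refl)

lemma runs_Seq:
  assumes "runs A T a T'" "runs B T' b T''"
  shows "runs (A ;; B) T (a + b) T''"
proof -
  obtain s t where s: "s \<le> a" "reach A (0, T) s (fst A, T')"
    and t: "t \<le> b" "reach B (0, T') t (fst B, T'')"
    using assms unfolding runs_def by auto
  have "reach (A ;; B) (apfst (\<lambda>q. q) (0, T)) s (apfst (\<lambda>q. q) (fst A, T'))"
    by (rule reach_embed[OF s(2)]) (auto simp: Seq_def apfst_def map_prod_def)
  moreover have "reach (A ;; B) (apfst ((+) (fst A)) (0, T')) t (apfst ((+) (fst A)) (fst B, T''))"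
    by (rule reach_embed[OF t(2)]) (auto simp: Seq_def)
  ultimately have "reach (A ;; B) (0, T) (s + t) (fst (A ;; B), T'')"
    by (auto simp: Seq_def intro: reach_trans)
  with s(1) t(1) show ?thesis
    unfolding runs_def by (meson add_mono)
qed

lemma act_scanned_Stay [simp]: "act (scanned t, Stay) t = t"
  by (cases t) (simp add: act_def scanned_def)

lemma map2_act_scanned_Stay: "map2 act (map (\<lambda>t. (scanned t, Stay)) T) T = T"
  by (induction T) auto

lemma runs_While_False:
  assumes "\<not> P (map scanned T)"
  shows "runs (While P A) T 1 T"
  unfolding runs_def
  by (intro exI[of _ 1] conjI order.refl, unfold One_nat_def, rule reach.step)
     (use assms in \<open>auto simp: While_def pstep_def comp_def map2_act_scanned_Stay intro: reach.refl\<close>)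

lemma runs_While_True:
  assumes "P (map scanned T)" "runs A T a T'" "runs (While P A) T' b T''"
  shows "runs (While P A) T (a + b + 1) T''"
proof -
  let ?W = "While P A" and ?\<phi> = "\<lambda>q. if q = fst A then 0 else Suc q"
  obtain s t where s: "s \<le> a" "reach A (0, T) s (fst A, T')"
    and t: "t \<le> b" "reach ?W (0, T') t (fst ?W, T'')"
    using assms unfolding runs_def by auto
  have emb: "reach ?W (apfst ?\<phi> (0, T)) s (apfst ?\<phi> (fst A, T'))"
    by (rule reach_embed[OF s(2)]) (auto simp: While_def)
  have first: "pstep ?W (0, T) = (1, T)"
    using assms(1) by (auto simp: While_def pstep_def comp_def map2_act_scanned_Stay)
  show ?thesis
  proof (cases "fst A = 0")
    \<comment> \<open>In a body without states entry and exit coincide, so the renaming sends its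
      entry to 0 instead of 1. Such a body changes nothing, and the run of the rest of the loop
      already is the run wanted.\<close>
    case True
    with s(2) have "T' = T"
      by (auto elim: reach.cases)
    with t assms show ?thesis
      unfolding runs_def by (meson trans_le_add1 trans_le_add2)
  next
    case False
    with emb have "reach ?W (1, T) s (0, T')"
      by simp
    then have "reach ?W (0, T) (Suc (s + t)) (fst ?W, T'')"
      using first t(2) by (intro reach.step) (auto simp: While_def intro: reach_trans)
    with s(1) t(1) show ?thesis
      unfolding runs_def by (intro exI[of _ "Suc (s + t)"]) auto
  qed
qed

lemma runs_While:
  assumes "\<And>k. k < n \<Longrightarrow> P (map scanned (S k))"
    and "\<And>k. k < n \<Longrightarrow> runs A (S k) b (S (Suc k))"
    and "\<not> P (map scanned (S n))"
  shows "runs (While P A) (S 0) (n * (b + 1) + 1) (S n)"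
proof -
  \<comment> \<open>Induction on the number \<open>m\<close> of rounds still to go;
    \<open>S k\<close> is the tape content before round \<open>k\<close>.\<close>
  have "m \<le> n \<Longrightarrow> runs (While P A) (S (n - m)) (m * (b + 1) + 1) (S n)" for m
  proof (induction m)
    case 0
    then show ?case using runs_While_False[of P "S n" A] assms(3) by simp
  next
    case (Suc m)
    have "runs (While P A) (S (Suc (n - Suc m))) (m * (b + 1) + 1) (S n)"
      using Suc by (simp add: Suc_diff_Suc)
    from runs_While_True[OF assms(1) assms(2) this] Suc.prems
    have "runs (While P A) (S (n - Suc m)) (b + (m * (b + 1) + 1) + 1) (S n)"
      by simp
    then show ?case by (rule runs_mono) simp
  qed
  from this[of n] show ?thesis by simp
qed

section \<open>From programs to Turing machines\<close>

definition symbol_list :: "nat \<Rightarrow> nat \<Rightarrow> nat list \<Rightarrow> bool" where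
  "symbol_list k m s \<longleftrightarrow> length s = k \<and> set s \<subseteq> {..<m}"

definition valid_actions :: "nat \<Rightarrow> nat \<Rightarrow> (nat list \<Rightarrow> (nat \<times> move) list) \<Rightarrow> bool" where
  "valid_actions k m f \<longleftrightarrow> (\<forall>s. symbol_list k m s \<longrightarrow> symbol_list k m (map fst (f s)))"

definition valid_prog :: "nat \<Rightarrow> nat \<Rightarrow> prog \<Rightarrow> bool" where
  "valid_prog k m A \<longleftrightarrow> (\<forall>q<fst A. valid_actions k m (\<lambda>s. snd (snd A q s)) \<and>
     (\<forall>s. symbol_list k m s \<longrightarrow> fst (snd A q s) \<le> fst A))"

lemma valid_prog_Do: "valid_actions k m f \<Longrightarrow> valid_prog k m (Do f)"
  by (simp add: valid_prog_def Do_def)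

lemma valid_prog_Seq: "valid_prog k m A \<Longrightarrow> valid_prog k m B \<Longrightarrow> valid_prog k m (A ;; B)"
  by (auto simp: valid_prog_def valid_actions_def Seq_def trans_le_add1)

lemma valid_prog_While: "valid_prog k m A \<Longrightarrow> valid_prog k m (While P A)"
  by (force simp: valid_prog_def valid_actions_def While_def comp_def)

text \<open>The exit of the program becomes the halting state. The transitions given there only keep
  \<open>delta\<close> well formed, since \<open>step\<close> does not consult them.\<close>

definition tm_of :: "nat \<Rightarrow> nat \<Rightarrow> prog \<Rightarrow> tm" where
  "tm_of k m A = \<lparr>num_tapes = k, num_states = Suc (fst A), num_symbols = m,
     start_state = 0, halt_state = fst A,
     delta = (\<lambda>q s. if q < fst A then snd A q s else (q, map (\<lambda>a. (a, Stay)) s))\<rparr>"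

lemma valid_tm_tm_of:
  assumes "valid_prog k m A" "0 < k" "3 \<le> m"
  shows "valid_tm (tm_of k m A)"
  using assms
  by (auto simp: valid_tm_def tm_of_def valid_prog_def valid_actions_def symbol_list_def less_Suc_eq_le)

lemma funpow_step_halted:
  "fst c = halt_state M \<Longrightarrow> (step M ^^ t) c = c"
  by (induction t) (auto simp: step_def)

lemma funpow_step_reach:
  "reach A c t c' \<Longrightarrow> (step (tm_of k m A) ^^ t) c = c'"
proof (induction rule: reach.induct)
  case (step c t c')
  then have "Defs.step (tm_of k m A) c = pstep A c"
    by (auto simp: Defs.step_def pstep_def tm_of_def)
  with step.IH show ?case
    by (simp add: funpow_swap1 del: funpow.simps add: funpow_Suc_right)
qed simp

lemma computes_within_tm_of:
  assumes "runs A (input_tape w # replicate (k - 1) blank_tape) b T"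
    and "b \<le> t" and "has_output (fst A, T) v"
  shows "computes_within (tm_of k m A) w v t"
proof -
  let ?M = "tm_of k m A"
  obtain s where s: "s \<le> b" "reach A (init_config ?M w) s (fst A, T)"
    using assms(1) unfolding runs_def by (auto simp: init_config_def tm_of_def)
  \<comment> \<open>The run takes \<open>s\<close> steps and the bound asks for exactly
    \<open>t\<close>; the difference is spent in the halted configuration.\<close>
  have "(step ?M ^^ t) (init_config ?M w) = (step ?M ^^ (t - s)) ((step ?M ^^ s) (init_config ?M w))"
    using s(1) assms(2) by (metis comp_apply funpow_add le_add_diff_inverse2 order.trans)
  also have "\<dots> = (fst A, T)"
    unfolding funpow_step_reach[OF s(2)] by (rule funpow_step_halted) (simp add: tm_of_def)
  finally show ?thesis
    using assms(3) by (simp add: computes_within_def tm_of_def)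
qed

section \<open>Loops over index tapes\<close>

definition keep :: "nat \<Rightarrow> nat \<times> move" where "keep a = (a, Stay)"
definition lt :: "nat \<Rightarrow> nat \<times> move" where "lt a = (a, MoveLeft)"
definition rt :: "nat \<Rightarrow> nat \<times> move" where "rt a = (a, MoveRight)"

definition pointwise :: "(nat \<Rightarrow> nat \<times> move) list \<Rightarrow> prog" where
  "pointwise fs = Do (map2 (\<lambda>f. f) fs)"

definition ruler :: "int \<Rightarrow> int \<Rightarrow> tape" where
  "ruler n x = (x, \<lambda>y. if 0 \<le> y \<and> y < n then 1 else 0)"

definition marked :: "int \<Rightarrow> tape" where
  "marked d = (d, \<lambda>y. if y = 0 then 1 else 0)"

definition written :: "bool list \<Rightarrow> int \<Rightarrow> tape" where
  "written l x = (x, snd (input_tape l))"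

lemma act_keep [simp]: "act (keep (scanned t)) t = t"
  by (simp add: keep_def)

lemma act_move:
  "act (rt (scanned t)) t = (fst t + 1, snd t)"
  "act (lt (scanned t)) t = (fst t - 1, snd t)"
  by (simp_all add: rt_def lt_def act_def scanned_def)

lemma act_move_simps [simp]:
  "act (rt (scanned (ruler n x))) (ruler n x) = ruler n (x + 1)"
  "act (lt (scanned (ruler n x))) (ruler n x) = ruler n (x - 1)"
  "act (rt (scanned (marked x))) (marked x) = marked (x + 1)"
  "act (lt (scanned (marked x))) (marked x) = marked (x - 1)"
  "act (rt (scanned (written l x))) (written l x) = written l (x + 1)"
  "act (lt (scanned (written l x))) (written l x) = written l (x - 1)"
  by (simp_all add: act_move ruler_def marked_def written_def)

lemma act_write_written:
  "act (bit_symbol b, MoveRight) (written l (int (length l))) = written (l @ [b]) (int (length (l @ [b])))"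
  by (auto simp: written_def act_def input_tape_def nth_append fun_eq_iff)

lemma act_write_ruler [simp]:
  "0 \<le> n \<Longrightarrow> act (1, MoveRight) (ruler n n) = ruler (n + 1) (n + 1)"
  "0 \<le> x \<Longrightarrow> act (0, MoveLeft) (ruler (x + 1) x) = ruler x (x - 1)"
  by (auto simp: ruler_def act_def fun_eq_iff)

lemma scanned_ruler: "scanned (ruler n x) = (if 0 \<le> x \<and> x < n then 1 else 0)"
  by (simp add: scanned_def ruler_def)

lemma scanned_marked: "scanned (marked d) = (if d = 0 then 1 else 0)"
  by (simp add: scanned_def marked_def)

text \<open>
  Loop indices are the head positions on the four rulers. On the other four tapes the head is kept at
  the difference of two indices while the only mark is at position 0, so that equality of
  indices can be read off the scanned symbol.
\<close>

definition tapes :: "bool list \<Rightarrow> int \<Rightarrow> bool list \<Rightarrow> int \<Rightarrow> int \<Rightarrow> int \<Rightarrow> int \<Rightarrow> int \<Rightarrow> tape list" where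
  "tapes w p l n i j i' j' =
     [written w p, written l (int (length l)), ruler n i, ruler n j, ruler n i', ruler n j',
      marked (i' - i), marked (j' - j), marked (j' - i), marked (i' - j)]"

lemma runs_pointwise: "map2 act (map2 (\<lambda>f. f) fs (map scanned T)) T = T' \<Longrightarrow> runs (pointwise fs) T 1 T'"
  unfolding pointwise_def by (rule runs_Do)

definition on_ruler :: "nat \<Rightarrow> nat list \<Rightarrow> bool" where
  "on_ruler k s \<longleftrightarrow> s ! k = 1"

text \<open>The first loop ends one cell beyond the ruler. The rest walks back to position -1 and
  steps onto 0, so that the index is reset and the loop can be nested in another.\<close>

definition For :: "nat \<Rightarrow> prog \<Rightarrow> prog \<Rightarrow> prog \<Rightarrow> prog" where
  "For k fwd bwd A = While (on_ruler k) (A ;; fwd) ;; bwd ;; While (on_ruler k) bwd ;; fwd"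

text \<open>In \<open>F y x\<close>, \<open>y\<close> is the index position and \<open>x\<close>
  counts the finished rounds. They are separate because the way back changes \<open>y\<close> but
  must preserve what the rounds have produced.\<close>

lemma runs_For:
  assumes body: "\<And>x. x < n \<Longrightarrow> runs A (F (int x) x) b (F (int x) (Suc x))"
    and fwd: "\<And>y x. runs fwd (F y x) 1 (F (y + 1) x)"
    and bwd: "\<And>y x. runs bwd (F y x) 1 (F (y - 1) x)"
    and on: "\<And>y x. on_ruler k (map scanned (F y x)) \<longleftrightarrow> 0 \<le> y \<and> y < int n"
  shows "runs (For k fwd bwd A) (F 0 0) (n * (b + 4) + 4) (F 0 n)"
proof -
  have "runs (A ;; fwd) (F (int x) x) (b + 1) (F (int (Suc x)) (Suc x))" if "x < n" for x
    using runs_Seq[OF body[OF that] fwd] by (simp add: add.commute)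
  then have 1: "runs (While (on_ruler k) (A ;; fwd)) (F 0 0) (n * (b + 1 + 1) + 1) (F (int n) n)"
    using runs_While[of n "on_ruler k" "\<lambda>x. F (int x) x" "A ;; fwd" "b + 1"] on by simp
  have "runs bwd (F (int n - 1 - int x) n) 1 (F (int n - 1 - int (Suc x)) n)" for x
    using bwd[of "int n - 1 - int x" n] by (simp add: algebra_simps)
  then have 2: "runs (While (on_ruler k) bwd) (F (int n - 1) n) (n * (1 + 1) + 1) (F (-1) n)"
    using runs_While[of n "on_ruler k" "\<lambda>x. F (int n - 1 - int x) n" bwd 1] on by simp
  have 3: "runs fwd (F (-1) n) 1 (F 0 n)"
    using fwd[of "-1" n] by simp
  show ?thesis
    unfolding For_def
    by (rule runs_mono[OF runs_Seq[OF 1 runs_Seq[OF bwd runs_Seq[OF 2 3]]]])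
       (simp add: algebra_simps)
qed

text \<open>Besides its ruler, an index moves the two difference tapes it occurs on: in the same
  direction for a primed index, in the opposite one for an unprimed index, which is
  subtracted.\<close>

definition fwd_i' where "fwd_i' = pointwise [keep, keep, keep, keep, rt, keep, rt, keep, keep, rt]"
definition bwd_i' where "bwd_i' = pointwise [keep, keep, keep, keep, lt, keep, lt, keep, keep, lt]"
definition fwd_j' where "fwd_j' = pointwise [keep, keep, keep, keep, keep, rt, keep, rt, rt, keep]"
definition bwd_j' where "bwd_j' = pointwise [keep, keep, keep, keep, keep, lt, keep, lt, lt, keep]"
definition fwd_i where "fwd_i = pointwise [keep, keep, rt, keep, keep, keep, lt, keep, lt, keep]"
definition bwd_i where "bwd_i = pointwise [keep, keep, lt, keep, keep, keep, rt, keep, rt, keep]"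
definition fwd_j where "fwd_j = pointwise [keep, keep, keep, rt, keep, keep, keep, lt, keep, lt]"
definition bwd_j where "bwd_j = pointwise [keep, keep, keep, lt, keep, keep, keep, rt, keep, rt]"

lemmas move_defs = fwd_i'_def bwd_i'_def fwd_j'_def bwd_j'_def fwd_i_def bwd_i_def fwd_j_def bwd_j_def

lemma runs_moves:
  "runs fwd_i' (tapes w p l n i j i' j') 1 (tapes w p l n i j (i' + 1) j')"
  "runs bwd_i' (tapes w p l n i j i' j') 1 (tapes w p l n i j (i' - 1) j')"
  "runs fwd_j' (tapes w p l n i j i' j') 1 (tapes w p l n i j i' (j' + 1))"
  "runs bwd_j' (tapes w p l n i j i' j') 1 (tapes w p l n i j i' (j' - 1))"
  "runs fwd_i (tapes w p l n i j i' j') 1 (tapes w p l n (i + 1) j i' j')"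
  "runs bwd_i (tapes w p l n i j i' j') 1 (tapes w p l n (i - 1) j i' j')"
  "runs fwd_j (tapes w p l n i j i' j') 1 (tapes w p l n i (j + 1) i' j')"
  "runs bwd_j (tapes w p l n i j i' j') 1 (tapes w p l n i (j - 1) i' j')"
  unfolding move_defs
  by (rule runs_pointwise; simp add: tapes_def algebra_simps)+

lemma on_ruler_tapes:
  "on_ruler 2 (map scanned (tapes w p l n i j i' j')) \<longleftrightarrow> 0 \<le> i \<and> i < n"
  "on_ruler 3 (map scanned (tapes w p l n i j i' j')) \<longleftrightarrow> 0 \<le> j \<and> j < n"
  "on_ruler 4 (map scanned (tapes w p l n i j i' j')) \<longleftrightarrow> 0 \<le> i' \<and> i' < n"
  "on_ruler 5 (map scanned (tapes w p l n i j i' j')) \<longleftrightarrow> 0 \<le> j' \<and> j' < n"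
  by (simp_all add: on_ruler_def tapes_def scanned_ruler)

definition emit :: "(nat list \<Rightarrow> bool) \<Rightarrow> prog" where
  "emit g = Do (\<lambda>s. map (\<lambda>k. if k = 1 then (bit_symbol (g s), MoveRight) else keep (s ! k)) [0..<10])"

lemma runs_emit:
  "runs (emit g) (tapes w p l n i j i' j') 1
     (tapes w p (l @ [g (map scanned (tapes w p l n i j i' j'))]) n i j i' j')"
  unfolding emit_def
  by (rule runs_Do) (simp add: tapes_def upt_rec act_write_written del: length_append)

type_synonym row = "(nat list \<Rightarrow> bool) \<times> (nat list \<Rightarrow> bool) \<times> (nat list \<Rightarrow> bool) \<times> (nat list \<Rightarrow> bool)"

fun write_row :: "row \<Rightarrow> prog" where
  "write_row (gB, gP, gT, gH) =
     For 4 fwd_i' bwd_i' (emit gB ;; For 5 fwd_j' bwd_j' (emit gP ;; emit gT ;; emit gH))"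

text \<open>\<open>S i' j' l\<close> stands for the symbols scanned at indices \<open>i'\<close>,
  \<open>j'\<close> with output \<open>l\<close>. The bit for a base vertex is tested at
  \<open>j' = 0\<close>, because it is written before the inner loop starts.\<close>

fun computes_row :: "row \<Rightarrow> (int \<Rightarrow> int \<Rightarrow> bool list \<Rightarrow> nat list) \<Rightarrow> nat \<Rightarrow> (gadget_vertex \<Rightarrow> bool) \<Rightarrow> bool" where
  "computes_row (gB, gP, gT, gH) S n h \<longleftrightarrow>
     (\<forall>l i j. i < n \<longrightarrow> gB (S (int i) 0 l) = h (Base i) \<and>
       (j < n \<longrightarrow> gP (S (int i) (int j) l) = h (Link i j) \<and>
         gT (S (int i) (int j) l) = h (Tail i j) \<and> gH (S (int i) (int j) l) = h (Head i j)))"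

lemma runs_write_row:
  assumes "computes_row g (\<lambda>i' j' l. map scanned (tapes w p l (int n) i j i' j')) n h"
  shows "runs (write_row g) (tapes w p l (int n) i j 0 0) (n * (n * 7 + 9) + 4)
    (tapes w p (l @ map h (gadget_vertices n)) (int n) i j 0 0)"
proof -
  obtain gB gP gT gH where g: "g = (gB, gP, gT, gH)"
    by (cases g)
  let ?T = "\<lambda>l. tapes w p l (int n) i j"
  have vals: "gB (map scanned (?T l (int a) 0)) = h (Base a)"
    "b < n \<Longrightarrow> gP (map scanned (?T l (int a) (int b))) = h (Link a b)"
    "b < n \<Longrightarrow> gT (map scanned (?T l (int a) (int b))) = h (Tail a b)"
    "b < n \<Longrightarrow> gH (map scanned (?T l (int a) (int b))) = h (Head a b)" if "a < n" for l a b
    using assms that unfolding g by simp_all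
  have emit: "runs (emit gB) (?T m (int a) 0) 1 (?T (m @ [h (Base a)]) (int a) 0)"
    "b < n \<Longrightarrow> runs (emit gP) (?T m (int a) (int b)) 1 (?T (m @ [h (Link a b)]) (int a) (int b))"
    "b < n \<Longrightarrow> runs (emit gT) (?T m (int a) (int b)) 1 (?T (m @ [h (Tail a b)]) (int a) (int b))"
    "b < n \<Longrightarrow> runs (emit gH) (?T m (int a) (int b)) 1 (?T (m @ [h (Head a b)]) (int a) (int b))"
    if "a < n" for m a b
    using runs_emit[of gB w p m "int n" i j "int a" 0] runs_emit[of gP w p m "int n" i j "int a" "int b"]
      runs_emit[of gT w p m "int n" i j "int a" "int b"] runs_emit[of gH w p m "int n" i j "int a" "int b"]
      vals[OF that, where l = m] by simp_all
  \<comment> \<open>Loop invariants: the output of the first \<open>b\<close> inner rounds of round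
    \<open>a\<close>, and below it that of the first \<open>a\<close> outer rounds.\<close>
  define inner where "inner a b = map h (concat (map (\<lambda>j. [Link a j, Tail a j, Head a j]) [0..<b]))" for a b
  define outer where "outer a = concat (map (\<lambda>i. h (Base i) # inner i n) [0..<a])" for a
  have inner: "runs (For 5 fwd_j' bwd_j' (emit gP ;; emit gT ;; emit gH)) (?T l (int a) 0) (n * 7 + 4)
      (?T (l @ inner a n) (int a) 0)" if a: "a < n" for a l
  proof -
    have body: "runs (emit gP ;; emit gT ;; emit gH) (?T (l @ inner a b) (int a) (int b)) 3
        (?T (l @ inner a (Suc b)) (int a) (int b))" if b: "b < n" for b
      using runs_Seq[OF emit(2)[OF a b] runs_Seq[OF emit(3)[OF a b] emit(4)[OF a b]], of "l @ inner a b"]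
      by (simp add: inner_def numeral_3_eq_3)
    have "runs (For 5 fwd_j' bwd_j' (emit gP ;; emit gT ;; emit gH)) (?T (l @ inner a 0) (int a) 0)
        (n * (3 + 4) + 4) (?T (l @ inner a n) (int a) 0)"
      by (rule runs_For[where F = "\<lambda>y b. ?T (l @ inner a b) (int a) y"])
         (simp_all only: body runs_moves on_ruler_tapes)
    then show ?thesis by (simp add: inner_def)
  qed
  have body: "runs (emit gB ;; For 5 fwd_j' bwd_j' (emit gP ;; emit gT ;; emit gH))
      (?T (l @ outer a) (int a) 0) (n * 7 + 5) (?T (l @ outer (Suc a)) (int a) 0)" if a: "a < n" for a
    using runs_Seq[OF emit(1)[OF a] inner[OF a], of "l @ outer a"]
    by (simp add: outer_def add.commute)
  have "runs (write_row g) (?T (l @ outer 0) 0 0) (n * (n * 7 + 5 + 4) + 4) (?T (l @ outer n) 0 0)"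
    unfolding g write_row.simps
    by (rule runs_For[where F = "\<lambda>y a. ?T (l @ outer a) y 0"])
       (simp_all only: body runs_moves on_ruler_tapes)
  moreover have "outer n = map h (gadget_vertices n)"
    by (simp add: outer_def inner_def gadget_vertices_def map_concat comp_def)
  ultimately show ?thesis
    by (simp add: outer_def add.commute)
qed

section \<open>Writing the gadget\<close>

definition same_i_i' :: "nat list \<Rightarrow> bool" where "same_i_i' s \<longleftrightarrow> s ! 6 = 1"
definition same_j_j' :: "nat list \<Rightarrow> bool" where "same_j_j' s \<longleftrightarrow> s ! 7 = 1"
definition same_i_j' :: "nat list \<Rightarrow> bool" where "same_i_j' s \<longleftrightarrow> s ! 8 = 1"
definition same_j_i' :: "nat list \<Rightarrow> bool" where "same_j_i' s \<longleftrightarrow> s ! 9 = 1"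

text \<open>Symbol 2 is the bit True. The input head rests on matrix entry \<open>(i, j)\<close>, so
  \<open>R\<close> is consulted only where a link meets its own pendants.\<close>

definition same_edge :: "nat list \<Rightarrow> bool" where
  "same_edge s \<longleftrightarrow> same_i_i' s \<and> same_j_j' s \<and> s ! 0 = 2"

definition True_row :: row where
  "True_row = (\<lambda>_. True, \<lambda>_. True, \<lambda>_. True, \<lambda>_. True)"
definition Base_row :: row where
  "Base_row = (\<lambda>_. False, \<lambda>_. True, same_i_i', same_i_j')"
definition Link_row :: row where
  "Link_row = (\<lambda>_. True, \<lambda>_. False, same_edge, same_edge)"
definition Tail_row :: row where
  "Tail_row = (same_i_i', same_edge, \<lambda>_. False, \<lambda>_. False)"
definition Head_row :: row where
  "Head_row = (same_j_i', same_edge, \<lambda>_. False, \<lambda>_. False)"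

lemma same_tapes:
  "same_i_i' (map scanned (tapes w p l n i j i' j')) \<longleftrightarrow> i = i'"
  "same_j_j' (map scanned (tapes w p l n i j i' j')) \<longleftrightarrow> j = j'"
  "same_i_j' (map scanned (tapes w p l n i j i' j')) \<longleftrightarrow> i = j'"
  "same_j_i' (map scanned (tapes w p l n i j i' j')) \<longleftrightarrow> j = i'"
  "same_edge (map scanned (tapes w p l n i j i' j')) \<longleftrightarrow> i = i' \<and> j = j' \<and> scanned (written w p) = 2"
  by (auto simp: same_edge_def same_i_i'_def same_j_j'_def same_i_j'_def same_j_i'_def tapes_def scanned_marked)

lemma computes_rows:
  "computes_row True_row (\<lambda>i' j' l. map scanned (tapes w p l (int n) i j i' j')) n (\<lambda>_. True)"
  "computes_row Base_row (\<lambda>i' j' l. map scanned (tapes w p l (int n) (int a) j i' j')) n (gadget_adj R (Base a))"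
  "scanned (written w p) = bit_symbol (R a b) \<Longrightarrow>
   computes_row Link_row (\<lambda>i' j' l. map scanned (tapes w p l (int n) (int a) (int b) i' j')) n (gadget_adj R (Link a b))"
  "scanned (written w p) = bit_symbol (R a b) \<Longrightarrow>
   computes_row Tail_row (\<lambda>i' j' l. map scanned (tapes w p l (int n) (int a) (int b) i' j')) n (gadget_adj R (Tail a b))"
  "scanned (written w p) = bit_symbol (R a b) \<Longrightarrow>
   computes_row Head_row (\<lambda>i' j' l. map scanned (tapes w p l (int n) (int a) (int b) i' j')) n (gadget_adj R (Head a b))"
  by (cases "R a b"; auto simp: True_row_def Base_row_def Link_row_def Tail_row_def Head_row_def same_tapes)+

definition next_bit :: prog where
  "next_bit = pointwise (rt # replicate 9 keep)"

lemma runs_next_bit: "runs next_bit (tapes w p l n i j i' j') 1 (tapes w (p + 1) l n i j i' j')"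
  unfolding next_bit_def by (rule runs_pointwise) (simp add: tapes_def numeral_eq_Suc)

definition row_time :: "nat \<Rightarrow> nat" where
  "row_time n = n * (n * 7 + 9) + 4"

text \<open>The input head stays on one matrix entry while the three rows belonging to it are
  written, and then advances. Since the code lists the matrix row by row, this is a single pass over
  it.\<close>

definition write_matrix :: prog where
  "write_matrix = For 2 fwd_i bwd_i (write_row Base_row ;;
     For 3 fwd_j bwd_j (write_row Link_row ;; write_row Tail_row ;; write_row Head_row ;; next_bit))"

definition matrix_time :: "nat \<Rightarrow> nat" where
  "matrix_time n = n * (row_time n + (n * (3 * row_time n + 1 + 4) + 4) + 4) + 4"

lemma runs_write_matrix:
  assumes bits: "\<And>a b. a < n \<Longrightarrow> b < n \<Longrightarrow> scanned (written w (p + int (a * n + b))) = bit_symbol (R a b)"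
  shows "runs write_matrix (tapes w p l (int n) 0 0 0 0) (matrix_time n)
    (tapes w (p + int (n * n)) (l @ concat (map (\<lambda>u. map (gadget_adj R u) (gadget_vertices n)) (gadget_vertices n)))
      (int n) 0 0 0 0)"
proof -
  define row where "row u = map (gadget_adj R u) (gadget_vertices n)" for u
  define inner where
    "inner a b = concat (map row (concat (map (\<lambda>j. [Link a j, Tail a j, Head a j]) [0..<b])))" for a b
  define outer where "outer a = concat (map (\<lambda>i. row (Base i) @ inner i n) [0..<a])" for a
  let ?T = "\<lambda>p m i j. tapes w p m (int n) i j 0 0"
  have inner: "runs (For 3 fwd_j bwd_j (write_row Link_row ;; write_row Tail_row ;; write_row Head_row ;; next_bit))
      (?T (p + int (a * n)) m (int a) 0) (n * (3 * row_time n + 1 + 4) + 4)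
      (?T (p + int (a * n + n)) (m @ inner a n) (int a) 0)" if a: "a < n" for a m
  proof -
    let ?p = "\<lambda>b. p + int (a * n + b)"
    have body: "runs (write_row Link_row ;; write_row Tail_row ;; write_row Head_row ;; next_bit)
        (?T (?p b) (m @ inner a b) (int a) (int b)) (3 * row_time n + 1)
        (?T (?p (Suc b)) (m @ inner a (Suc b)) (int a) (int b))" if b: "b < n" for b
    proof -
      have "runs (write_row Link_row ;; write_row Tail_row ;; write_row Head_row ;; next_bit)
          (?T (?p b) k (int a) (int b)) (3 * row_time n + 1)
          (?T (?p b + 1) (((k @ row (Link a b)) @ row (Tail a b)) @ row (Head a b)) (int a) (int b))" for k
        unfolding row_time_def row_def
        by (rule runs_mono[OF runs_Seq[OF runs_write_row[OF computes_rows(3)[of w _ R a b, OF bits[OF a b]]]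
              runs_Seq[OF runs_write_row[OF computes_rows(4)[of w _ R a b, OF bits[OF a b]]]
              runs_Seq[OF runs_write_row[OF computes_rows(5)[of w _ R a b, OF bits[OF a b]]] runs_next_bit]]]]) simp
      from this[of "m @ inner a b"] show ?thesis
        by (simp add: inner_def algebra_simps)
    qed
    have "runs (For 3 fwd_j bwd_j (write_row Link_row ;; write_row Tail_row ;; write_row Head_row ;; next_bit))
        (?T (?p 0) (m @ inner a 0) (int a) 0) (n * (3 * row_time n + 1 + 4) + 4)
        (?T (?p n) (m @ inner a n) (int a) 0)"
      by (rule runs_For[where F = "\<lambda>y b. ?T (?p b) (m @ inner a b) (int a) y"])
         (simp_all only: body runs_moves on_ruler_tapes)
    then show ?thesis by (simp add: inner_def)
  qed
  let ?p = "\<lambda>a. p + int (a * n)"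
  have body: "runs (write_row Base_row ;;
      For 3 fwd_j bwd_j (write_row Link_row ;; write_row Tail_row ;; write_row Head_row ;; next_bit))
      (?T (?p a) (l @ outer a) (int a) 0) (row_time n + (n * (3 * row_time n + 1 + 4) + 4))
      (?T (?p (Suc a)) (l @ outer (Suc a)) (int a) 0)" if a: "a < n" for a
  proof -
    have "runs (write_row Base_row) (?T (?p a) m (int a) 0) (row_time n)
        (?T (?p a) (m @ row (Base a)) (int a) 0)" for m
      unfolding row_def row_time_def by (rule runs_write_row[OF computes_rows(2)])
    from runs_Seq[OF this inner[OF a], of "l @ outer a"] show ?thesis
      by (simp add: outer_def algebra_simps)
  qed
  have "runs write_matrix (?T (?p 0) (l @ outer 0) 0 0) (matrix_time n) (?T (?p n) (l @ outer n) 0 0)"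
    unfolding write_matrix_def matrix_time_def
    by (rule runs_For[where F = "\<lambda>y a. ?T (?p a) (l @ outer a) y 0"])
       (simp_all only: body runs_moves on_ruler_tapes)
  \<comment> \<open>The concatenation produced by the loops is regrouped into one row for each
    element of the vertex list.\<close>
  moreover have "outer m = concat (map row
      (concat (map (\<lambda>i. Base i # concat (map (\<lambda>j. [Link i j, Tail i j, Head i j]) [0..<n])) [0..<m])))" for m
    by (induction m) (simp_all add: outer_def inner_def)
  then have "outer n = concat (map row (gadget_vertices n))"
    by (simp add: gadget_vertices_def)
  ultimately show ?thesis
    by (simp add: outer_def row_def[abs_def])
qed

section \<open>Loading and erasing the vertex number\<close>

definition rulers :: "(nat \<Rightarrow> nat \<times> move) \<Rightarrow> (nat \<Rightarrow> nat \<times> move) \<Rightarrow> prog" where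
  "rulers f g = pointwise ([f, keep] @ replicate 4 g @ replicate 4 keep)"

text \<open>All four indices move together, so their differences remain 0 and the difference tapes
  stand still.\<close>

lemma runs_rulers:
  assumes "act (g (scanned (ruler n x))) (ruler n x) = ruler m y"
  shows "runs (rulers keep g) (tapes w p l n x x x x) 1 (tapes w p l m y y y y)"
    and "runs (rulers rt g) (tapes w p l n x x x x) 1 (tapes w (p + 1) l m y y y y)"
  unfolding rulers_def by (rule runs_pointwise; simp add: tapes_def numeral_eq_Suc assms)+

definition load_rulers :: prog where
  "load_rulers = While (\<lambda>s. s ! 0 = 2) (rulers rt (\<lambda>_. (1, MoveRight))) ;; rulers rt lt ;;
     While (on_ruler 2) (rulers keep lt) ;; rulers keep rt"

lemma runs_load_rulers:
  assumes "\<And>k. k < n \<Longrightarrow> scanned (written w (p + int k)) = 2"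
    and "scanned (written w (p + int n)) \<noteq> 2"
  shows "runs load_rulers (tapes w p l 0 0 0 0 0) (4 * n + 4) (tapes w (p + int n + 1) l (int n) 0 0 0 0)"
proof -
  \<comment> \<open>After \<open>k\<close> bits of the unary header the rulers carry
    \<open>k\<close> marks and their heads are on the first free cell.\<close>
  let ?T = "\<lambda>k. tapes w (p + int k) l (int k) (int k) (int k) (int k) (int k)"
  have "act (1, MoveRight) (ruler (int k) (int k)) = ruler (int (Suc k)) (int (Suc k))" for k
    by (subst act_write_ruler(1)) (simp_all add: add.commute)
  then have "runs (rulers rt (\<lambda>_. (1, MoveRight))) (?T k) 1 (?T (Suc k))" for k
    using runs_rulers(2)[of "\<lambda>_. (1, MoveRight)" "int k" "int k" "int (Suc k)" "int (Suc k)" w "p + int k" l]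
    by (simp add: ac_simps)
  then have 1: "runs (While (\<lambda>s. s ! 0 = 2) (rulers rt (\<lambda>_. (1, MoveRight)))) (?T 0) (n * (1 + 1) + 1) (?T n)"
    by (intro runs_While) (use assms in \<open>simp_all add: tapes_def\<close>)
  let ?U = "\<lambda>x. tapes w (p + int n + 1) l (int n) x x x x"
  \<comment> \<open>One step passes the separator on the input tape and puts the ruler heads back on
    the last mark, or on -1 if there is none.\<close>
  have 2: "runs (rulers rt lt) (?T n) 1 (?U (int n - 1))"
    by (rule runs_rulers) simp
  have move: "runs (rulers keep lt) (?U x) 1 (?U (x - 1))" "runs (rulers keep rt) (?U x) 1 (?U (x + 1))" for x
    by (rule runs_rulers; simp)+
  have "runs (rulers keep lt) (?U (int n - 1 - int k)) 1 (?U (int n - 1 - int (Suc k)))" for k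
    using move(1)[of "int n - 1 - int k"] by (simp add: algebra_simps)
  then have 3: "runs (While (on_ruler 2) (rulers keep lt)) (?U (int n - 1)) (n * (1 + 1) + 1) (?U (-1))"
    using runs_While[of n "on_ruler 2" "\<lambda>k. ?U (int n - 1 - int k)" "rulers keep lt" 1]
    by (simp add: on_ruler_tapes)
  have 4: "runs (rulers keep rt) (?U (-1)) 1 (?U 0)"
    using move(2)[of "-1"] by simp
  show ?thesis
    unfolding load_rulers_def
    using runs_mono[OF runs_Seq[OF 1 runs_Seq[OF 2 runs_Seq[OF 3 4]]], of "4 * n + 4"] by simp
qed

definition erase_rulers :: prog where
  "erase_rulers = While (on_ruler 2) (rulers keep rt) ;; rulers keep lt ;;
     While (on_ruler 2) (rulers keep (\<lambda>_. (0, MoveLeft))) ;; rulers keep rt"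

lemma runs_erase_rulers:
  "runs erase_rulers (tapes w p l (int n) 0 0 0 0) (4 * n + 4) (tapes w p l 0 0 0 0 0)"
proof -
  let ?U = "\<lambda>n x. tapes w p l n x x x x"
  have move: "runs (rulers keep lt) (?U n x) 1 (?U n (x - 1))" "runs (rulers keep rt) (?U n x) 1 (?U n (x + 1))" for n x
    by (rule runs_rulers; simp)+
  have "runs (rulers keep rt) (?U (int n) (int k)) 1 (?U (int n) (int (Suc k)))" for k
    using move(2)[of "int n" "int k"] by (simp add: add.commute)
  then have 1: "runs (While (on_ruler 2) (rulers keep rt)) (?U (int n) 0) (n * (1 + 1) + 1) (?U (int n) (int n))"
    using runs_While[of n "on_ruler 2" "\<lambda>k. ?U (int n) (int k)" "rulers keep rt" 1]
    by (simp add: on_ruler_tapes)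
  \<comment> \<open>Erasing goes from right to left: after \<open>k\<close> erasures the heads stand
    on the last of the \<open>n - k\<close> remaining marks.\<close>
  have "runs (rulers keep (\<lambda>_. (0, MoveLeft))) (?U (int n - int k) (int n - int k - 1)) 1
      (?U (int n - int (Suc k)) (int n - int (Suc k) - 1))" if "k < n" for k
    using act_write_ruler(2)[of "int n - int (Suc k)"] that
    by (intro runs_rulers) (simp add: algebra_simps)
  then have 2: "runs (While (on_ruler 2) (rulers keep (\<lambda>_. (0, MoveLeft)))) (?U (int n) (int n - 1))
      (n * (1 + 1) + 1) (?U 0 (-1))"
    using runs_While[of n "on_ruler 2" "\<lambda>k. ?U (int n - int k) (int n - int k - 1)"
        "rulers keep (\<lambda>_. (0, MoveLeft))" 1]
    by (simp add: on_ruler_tapes)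
  have 3: "runs (rulers keep rt) (?U 0 (-1)) 1 (?U 0 0)"
    using move(2)[of 0 "-1"] by simp
  show ?thesis
    unfolding erase_rulers_def
    by (rule runs_mono[OF runs_Seq[OF 1 runs_Seq[OF move(1) runs_Seq[OF 2 3]]]]) simp
qed

text \<open>\<open>True_row\<close> followed by a False bit writes the unary header and the
  separator of the gadget code. Erasing the rulers at the end prepares the tapes for another
  graph.\<close>

definition transform :: prog where
  "transform = load_rulers ;; write_row True_row ;; emit (\<lambda>_. False) ;; write_matrix ;; erase_rulers"

definition transform_time :: "nat \<Rightarrow> nat" where
  "transform_time n = 8 * n + 9 + row_time n + matrix_time n"

lemma scanned_written:
  "scanned (written (u @ v) (int (length u) + int k)) = (if k < length v then bit_symbol (v ! k) else 0)"
  by (auto simp: scanned_def written_def input_tape_def nth_append nat_add_distrib)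

lemma nth_concat_map_upt:
  assumes "\<And>i. i < n \<Longrightarrow> length (f i) = m" "a < n" "b < m"
  shows "concat (map f [0..<n]) ! (a * m + b) = f a ! b"
  using assms
proof (induction n)
  case (Suc n)
  have len: "length (concat (map f [0..<n])) = n * m"
    using Suc.prems(1) by (induction n) auto
  show ?case
  proof (cases "a = n")
    case False
    with Suc.prems have "Suc a * m \<le> n * m"
      by (intro mult_le_mono1) simp
    with Suc.prems(3) have "a * m + b < n * m"
      by simp
    with Suc False len show ?thesis by (simp add: nth_append)
  qed (use Suc.prems len in \<open>simp add: nth_append\<close>)
qed simp

text \<open>The surrounding words \<open>u\<close> and \<open>v\<close> and the earlier output
  \<open>l\<close> allow the same program to be run twice, once for each graph of the pair.\<close>

lemma runs_transform:
  assumes w: "w = u @ encode_graph G @ v"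
  shows "runs transform (tapes w (int (length u)) l 0 0 0 0 0) (transform_time (card (verts G)))
    (tapes w (int (length (u @ encode_graph G))) (l @ encode_graph (gadget G)) 0 0 0 0 0)"
proof -
  define n where "n = card (verts G)"
  define A where "A = concat (map (\<lambda>i. map (\<lambda>j. {i, j} \<in> edges G) [0..<n]) [0..<n])"
  have len_A: "length A = n * n"
    by (simp add: A_def length_concat comp_def sum_list_triv)
  have enc: "encode_graph G = replicate n True @ False # A"
    by (simp add: encode_graph_def n_def A_def Let_def)
  have A_nth: "a * n + b < n * n \<and> A ! (a * n + b) = adjacent G a b" if "a < n" "b < n" for a b
  proof
    have "a * n + b < Suc a * n" using that by simp
    also have "\<dots> \<le> n * n" using that by (intro mult_le_mono1) simp
    finally show "a * n + b < n * n" .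
    show "A ! (a * n + b) = adjacent G a b"
      unfolding A_def adjacent_def using that by (subst nth_concat_map_upt) auto
  qed
  let ?p = "int (length u)"
  have scan: "scanned (written w (?p + int k)) = bit_symbol ((encode_graph G @ v) ! k)"
    if "k < length (encode_graph G)" for k
    unfolding w using that scanned_written[of u "encode_graph G @ v" k] by simp
  have load: "runs load_rulers (tapes w ?p l 0 0 0 0 0) (4 * n + 4) (tapes w (?p + int n + 1) l (int n) 0 0 0 0)"
    by (rule runs_load_rulers) (use scan in \<open>simp_all add: enc nth_append\<close>)
  have header: "runs (write_row True_row) (tapes w p l (int n) 0 0 0 0) (row_time n)
      (tapes w p (l @ map (\<lambda>_. True) (gadget_vertices n)) (int n) 0 0 0 0)" for p l
    unfolding row_time_def by (rule runs_write_row[OF computes_rows(1)])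
  have matrix: "runs write_matrix (tapes w (?p + int n + 1) l (int n) 0 0 0 0) (matrix_time n)
      (tapes w (?p + int n + 1 + int (n * n))
        (l @ concat (map (\<lambda>u. map (gadget_adj (adjacent G) u) (gadget_vertices n)) (gadget_vertices n))) (int n) 0 0 0 0)" for l
  proof (rule runs_write_matrix)
    fix a b assume "a < n" "b < n"
    note A_nth = A_nth[OF this]
    then have "scanned (written w (?p + int (n + 1 + (a * n + b)))) = bit_symbol (adjacent G a b)"
      using scan[of "n + 1 + (a * n + b)"] by (simp add: enc len_A nth_append)
    then show "scanned (written w (?p + int n + 1 + int (a * n + b))) = bit_symbol (adjacent G a b)"
      by (simp add: algebra_simps)
  qed
  have position: "?p + int n + 1 + int (n * n) = int (length (u @ encode_graph G))"
    by (simp add: enc len_A)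
  have code: "((l @ map (\<lambda>_. True) (gadget_vertices n)) @ [False]) @
      concat (map (\<lambda>u. map (gadget_adj (adjacent G) u) (gadget_vertices n)) (gadget_vertices n)) = l @ encode_graph (gadget G)"
    by (simp add: encode_gadget n_def Let_def map_replicate_const)
  have "runs transform (tapes w ?p l 0 0 0 0 0)
      (4 * n + 4 + (row_time n + (1 + (matrix_time n + (4 * n + 4)))))
      (tapes w (int (length (u @ encode_graph G))) (l @ encode_graph (gadget G)) 0 0 0 0 0)"
    unfolding transform_def code[symmetric] position[symmetric]
    by (rule runs_Seq[OF load runs_Seq[OF header runs_Seq[OF runs_emit[of "\<lambda>_. False"]
          runs_Seq[OF matrix runs_erase_rulers]]]])
  then show ?thesis
    by (rule runs_mono) (simp add: transform_time_def n_def)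
qed

section \<open>Copying the output to the first tape\<close>

definition blank_rest :: "tape list" where
  "blank_rest = replicate 4 (ruler 0 0) @ replicate 4 (marked 0)"

definition two_tapes :: "(nat \<Rightarrow> nat \<times> move) \<Rightarrow> (nat \<Rightarrow> nat \<times> move) \<Rightarrow> prog" where
  "two_tapes f g = pointwise (f # g # replicate 8 keep)"

lemma runs_two_tapes:
  "act (f (scanned s)) s = s' \<Longrightarrow> act (g (scanned t)) t = t' \<Longrightarrow>
    runs (two_tapes f g) (s # t # blank_rest) 1 (s' # t' # blank_rest)"
  unfolding two_tapes_def by (rule runs_pointwise) (simp add: blank_rest_def numeral_eq_Suc)

definition copy_symbol :: prog where
  "copy_symbol = Do (\<lambda>s. map (\<lambda>k. if k = 0 then (s ! 1, MoveRight) else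
     if k = 1 then rt (s ! k) else keep (s ! k)) [0..<10])"

lemma runs_copy_symbol:
  "runs copy_symbol (s # t # blank_rest) 1
     (act (scanned t, MoveRight) s # act (rt (scanned t)) t # blank_rest)"
  unfolding copy_symbol_def
  by (rule runs_Do) (simp add: blank_rest_def upt_rec numeral_eq_Suc)

text \<open>
  The output goes behind the input, after one blank cell at which the head stops when it moves
  back to the beginning of the output.
\<close>

definition copied :: "bool list \<Rightarrow> bool list \<Rightarrow> nat \<Rightarrow> int \<Rightarrow> tape" where
  "copied w l k x = (x, \<lambda>y. if int (length w) < y \<and> y \<le> int (length w + k)
     then bit_symbol (l ! nat (y - int (length w) - 1)) else snd (input_tape w) y)"

lemma copied_0: "copied w l 0 x = written w x"
  by (auto simp: copied_def written_def fun_eq_iff)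

lemma bit_symbol_pos [simp]: "0 < bit_symbol b" "bit_symbol b \<noteq> 0"
  by (cases b; simp)+

lemma scanned_written_eq_0: "scanned (written l x) = 0 \<longleftrightarrow> x < 0 \<or> int (length l) \<le> x"
  by (auto simp: scanned_def written_def input_tape_def)

lemma act_copy:
  assumes "k < length l"
  shows "act (scanned (written l (int k)), MoveRight) (copied w l k (int (length w + 1 + k))) =
    copied w l (Suc k) (int (length w + 1 + Suc k))"
  using assms
  by (auto simp: act_def copied_def scanned_def written_def input_tape_def fun_eq_iff)

text \<open>The first step skips the separating blank on tape 0 and puts the other head on the last
  output symbol. The loops then rewind the output, copy it, and return on tape 0 to the blank, from
  which one step right reaches the copy.\<close>

definition finish :: prog where
  "finish = two_tapes rt lt ;; While (\<lambda>s. s ! 1 \<noteq> 0) (two_tapes keep lt) ;; two_tapes keep rt ;;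
     While (\<lambda>s. s ! 1 \<noteq> 0) copy_symbol ;; two_tapes lt keep ;;
     While (\<lambda>s. s ! 0 \<noteq> 0) (two_tapes lt keep) ;; two_tapes rt keep"

lemma runs_finish:
  "runs finish (tapes w (int (length w)) l 0 0 0 0 0) (6 * length l + 7)
     (copied w l (length l) (int (length w + 1)) # written l (int (length l)) # blank_rest)"
proof -
  define h m where "h = int (length w + 1)" and "m = length l"
  let ?T = "\<lambda>s x. s # written l x # blank_rest"
  have init: "tapes w (int (length w)) l 0 0 0 0 0 = ?T (written w (int (length w))) (int m)"
    by (simp add: tapes_def blank_rest_def numeral_eq_Suc m_def)
  have 1: "runs (two_tapes rt lt) (?T (written w (int (length w))) (int m)) 1 (?T (written w h) (int m - 1))"
    by (rule runs_two_tapes) (simp_all add: h_def add.commute)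
  have "runs (two_tapes keep lt) (?T s (int m - 1 - int k)) 1 (?T s (int m - 1 - int (Suc k)))" for s k
    by (rule runs_two_tapes) (simp_all add: algebra_simps)
  then have 2: "runs (While (\<lambda>s. s ! 1 \<noteq> 0) (two_tapes keep lt)) (?T s (int m - 1)) (m * (1 + 1) + 1) (?T s (-1))"
    for s
    using runs_While[of m "\<lambda>s. s ! 1 \<noteq> 0" "\<lambda>k. ?T s (int m - 1 - int k)" "two_tapes keep lt" 1]
    by (auto simp: scanned_written_eq_0 m_def)
  have 3: "runs (two_tapes keep rt) (?T s (-1)) 1 (?T s 0)" for s
    by (rule runs_two_tapes) simp_all
  have "runs copy_symbol (?T (copied w l k (h + int k)) (int k)) 1
      (?T (copied w l (Suc k) (h + int (Suc k))) (int (Suc k)))" if "k < m" for k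
    using runs_copy_symbol[of "copied w l k (h + int k)" "written l (int k)"] act_copy[of k l w] that
    by (simp add: h_def m_def add_ac)
  then have 4: "runs (While (\<lambda>s. s ! 1 \<noteq> 0) copy_symbol) (?T (written w h) 0) (m * (1 + 1) + 1)
      (?T (copied w l m (h + int m)) (int m))"
    using runs_While[of m "\<lambda>s. s ! 1 \<noteq> 0" "\<lambda>k. ?T (copied w l k (h + int k)) (int k)" copy_symbol 1]
    by (auto simp: scanned_written_eq_0 m_def copied_0)
  have move: "runs (two_tapes lt keep) (?T (copied w l m x) y) 1 (?T (copied w l m (x - 1)) y)"
    "runs (two_tapes rt keep) (?T (copied w l m x) y) 1 (?T (copied w l m (x + 1)) y)" for x y
    by (rule runs_two_tapes; simp add: act_move copied_def)+
  have "runs (two_tapes lt keep) (?T (copied w l m (h + int m - 1 - int k)) y) 1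
      (?T (copied w l m (h + int m - 1 - int (Suc k))) y)" for k y
    using move(1)[of "h + int m - 1 - int k" y] by (simp add: algebra_simps)
  \<comment> \<open>The copy contains no blanks, so the loop makes exactly \<open>m\<close> moves
    and stops at \<open>h - 1\<close>, the blank between input and copy.\<close>
  then have 5: "runs (While (\<lambda>s. s ! 0 \<noteq> 0) (two_tapes lt keep)) (?T (copied w l m (h + int m - 1)) y)
      (m * (1 + 1) + 1) (?T (copied w l m (h - 1)) y)" for y
    using runs_While[of m "\<lambda>s. s ! 0 \<noteq> 0" "\<lambda>k. ?T (copied w l m (h + int m - 1 - int k)) y" "two_tapes lt keep" 1]
    by (auto simp: scanned_def copied_def input_tape_def h_def)
  have 6: "runs (two_tapes rt keep) (?T (copied w l m (h - 1)) y) 1 (?T (copied w l m h) y)" for y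
    using move(2)[of "h - 1" y] by simp
  show ?thesis
    unfolding init finish_def h_def[symmetric] m_def[symmetric]
    by (rule runs_mono[OF runs_Seq[OF 1 runs_Seq[OF 2 runs_Seq[OF 3 runs_Seq[OF 4
            runs_Seq[OF move(1) runs_Seq[OF 5 6]]]]]]]) simp
qed

lemma has_output_copied:
  "has_output (q, copied w l (length l) (int (length w + 1)) # T) l"
  by (auto simp: has_output_def copied_def input_tape_def)

text \<open>All indices start at 0, hence so do their differences, and each mark belongs under the
  initial head.\<close>

definition init_marks :: prog where
  "init_marks = pointwise (replicate 6 keep @ replicate 4 (\<lambda>_. (1, Stay)))"

lemma runs_init_marks:
  "runs init_marks (input_tape w # replicate 9 blank_tape) 1 (tapes w 0 [] 0 0 0 0 0)"
proof -
  have "written w 0 = input_tape w" "written [] 0 = blank_tape" "ruler 0 0 = blank_tape"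
    "act (1, Stay) blank_tape = marked 0"
    by (auto simp: written_def input_tape_def blank_tape_def ruler_def act_def marked_def fun_eq_iff)
  then show ?thesis
    unfolding init_marks_def
    by (intro runs_pointwise) (simp add: tapes_def numeral_eq_Suc)
qed

definition reduction :: prog where
  "reduction = init_marks ;; transform ;; transform ;; finish"

definition gadget_length :: "nat \<Rightarrow> nat" where
  "gadget_length n = n * (1 + 3 * n) + 1 + n * (1 + 3 * n) * (n * (1 + 3 * n))"

lemma length_encode_graph:
  "length (encode_graph G) = card (verts G) + 1 + card (verts G) * card (verts G)"
  by (simp add: encode_graph_def Let_def length_concat comp_def sum_list_triv)

lemma length_encode_gadget: "length (encode_graph (gadget G)) = gadget_length (card (verts G))"
  by (simp add: length_encode_graph gadget_length_def verts_gadget length_gadget_vertices)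

definition reduction_time :: "nat \<Rightarrow> nat" where
  "reduction_time n = 2 * transform_time n + 12 * gadget_length n + 8"

lemma mono_time:
  assumes "n \<le> m"
  shows "transform_time n \<le> transform_time m" "gadget_length n \<le> gadget_length m"
  unfolding transform_time_def matrix_time_def row_time_def gadget_length_def
  using assms by (intro add_mono mult_mono order.refl; simp)+

lemma runs_reduction:
  fixes G H :: "nat graph"
  defines "w \<equiv> encode_graph G @ encode_graph H"
    and "v \<equiv> encode_graph (gadget G) @ encode_graph (gadget H)"
  shows "runs reduction (input_tape w # replicate 9 blank_tape) (reduction_time (length w))
    (copied w v (length v) (int (length w + 1)) # written v (int (length v)) # blank_rest)"
proof -
  have 1: "runs transform (tapes w 0 [] 0 0 0 0 0) (transform_time (card (verts G)))
      (tapes w (int (length (encode_graph G))) (encode_graph (gadget G)) 0 0 0 0 0)"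
    using runs_transform[of w "[]" G "encode_graph H" "[]"] by (simp add: w_def)
  have 2: "runs transform (tapes w (int (length (encode_graph G))) (encode_graph (gadget G)) 0 0 0 0 0)
      (transform_time (card (verts H))) (tapes w (int (length w)) v 0 0 0 0 0)"
    using runs_transform[of w "encode_graph G" H "[]" "encode_graph (gadget G)"]
    by (simp add: w_def v_def)
  \<comment> \<open>The unary headers bound both vertex numbers by the input length, so monotonicity
    turns bounds in the vertex numbers into a bound in the input length.\<close>
  have le: "card (verts G) \<le> length w" "card (verts H) \<le> length w"
    by (simp_all add: w_def length_encode_graph)
  \<comment> \<open>Two gadget codes, copied at 6 steps per symbol, account for the factor 12 in
    \<open>reduction_time\<close>; its constant 8 is the initial marking together with the 7 fixed
    steps of \<open>finish\<close>.\<close>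
  have "length v \<le> 2 * gadget_length (length w)"
    using mono_time(2)[OF le(1)] mono_time(2)[OF le(2)] by (simp add: v_def length_encode_gadget)
  then show ?thesis
    using mono_time(1)[OF le(1)] mono_time(1)[OF le(2)]
    unfolding reduction_def
    by (intro runs_mono[OF runs_Seq[OF runs_init_marks runs_Seq[OF 1 runs_Seq[OF 2 runs_finish]]]])
       (simp add: reduction_time_def)
qed

section \<open>Polynomiality of the time bound\<close>

definition is_poly :: "(nat \<Rightarrow> nat) \<Rightarrow> bool" where
  "is_poly f \<longleftrightarrow> (\<exists>p. \<forall>x. poly p x = f x)"

lemma is_poly_intros:
  "is_poly (\<lambda>x. c)" "is_poly (\<lambda>x. x)"
  "is_poly f \<Longrightarrow> is_poly g \<Longrightarrow> is_poly (\<lambda>x. f x + g x)"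
  "is_poly f \<Longrightarrow> is_poly g \<Longrightarrow> is_poly (\<lambda>x. f x * g x)"
proof -
  show "is_poly (\<lambda>x. c)" unfolding is_poly_def by (rule exI[of _ "[:c:]"]) simp
  show "is_poly (\<lambda>x. x)" unfolding is_poly_def by (rule exI[of _ "[:0, 1:]"]) simp
  assume "is_poly f" "is_poly g"
  then obtain p q where "\<And>x. poly p x = f x" "\<And>x. poly q x = g x"
    unfolding is_poly_def by auto
  then show "is_poly (\<lambda>x. f x + g x)" "is_poly (\<lambda>x. f x * g x)"
    unfolding is_poly_def by (metis poly_add, metis poly_mult)
qed

lemma is_poly_reduction_time: "is_poly reduction_time"
  unfolding reduction_time_def[abs_def] transform_time_def matrix_time_def row_time_def gadget_length_def
  by (intro is_poly_intros)

section \<open>Well-formedness of the machine with ten tapes and three symbols\<close>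

lemma valid_pointwise:
  assumes "length fs = k" "\<And>f a. f \<in> set fs \<Longrightarrow> a < m \<Longrightarrow> fst (f a) < m"
  shows "valid_prog k m (pointwise fs)"
  unfolding pointwise_def
proof (rule valid_prog_Do)
  show "valid_actions k m (map2 (\<lambda>f. f) fs)"
    using assms by (auto simp: valid_actions_def symbol_list_def set_zip subset_iff)
qed

lemma fst_move [simp]: "fst (keep a) = a" "fst (lt a) = a" "fst (rt a) = a"
  by (simp_all add: keep_def lt_def rt_def)

lemma valid_map_upt:
  assumes "\<And>s j. symbol_list k m s \<Longrightarrow> j < k \<Longrightarrow> fst (g s j) < m"
  shows "valid_prog k m (Do (\<lambda>s. map (g s) [0..<k]))"
  using assms by (intro valid_prog_Do) (auto simp: valid_actions_def symbol_list_def)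

lemma valid_emit: "valid_prog 10 3 (emit g)"
proof -
  have "bit_symbol b < 3" for b by (cases b) auto
  then show ?thesis
    unfolding emit_def by (intro valid_map_upt) (auto simp: symbol_list_def subset_iff)
qed

lemma valid_copy_symbol: "valid_prog 10 3 copy_symbol"
  unfolding copy_symbol_def by (intro valid_map_upt) (auto simp: symbol_list_def subset_iff)

lemma valid_moves:
  "valid_prog 10 3 fwd_i'" "valid_prog 10 3 bwd_i'" "valid_prog 10 3 fwd_j'" "valid_prog 10 3 bwd_j'"
  "valid_prog 10 3 fwd_i" "valid_prog 10 3 bwd_i" "valid_prog 10 3 fwd_j" "valid_prog 10 3 bwd_j"
  "valid_prog 10 3 next_bit" "valid_prog 10 3 init_marks"
  unfolding move_defs next_bit_def init_marks_def
  by (rule valid_pointwise; auto)+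

lemma valid_rulers:
  "(\<And>a. a < 3 \<Longrightarrow> fst (f a) < 3) \<Longrightarrow> (\<And>a. a < 3 \<Longrightarrow> fst (g a) < 3) \<Longrightarrow> valid_prog 10 3 (rulers f g)"
  "(\<And>a. a < 3 \<Longrightarrow> fst (f a) < 3) \<Longrightarrow> (\<And>a. a < 3 \<Longrightarrow> fst (g a) < 3) \<Longrightarrow> valid_prog 10 3 (two_tapes f g)"
  unfolding rulers_def two_tapes_def by (rule valid_pointwise; auto)+

lemma valid_write_row: "valid_prog 10 3 (write_row g)"
  by (cases g) (simp add: For_def valid_prog_Seq valid_prog_While valid_emit valid_moves)

lemma valid_reduction: "valid_prog 10 3 reduction"
  unfolding reduction_def transform_def load_rulers_def erase_rulers_def write_matrix_def finish_def For_def
  by (intro valid_prog_Seq valid_prog_While valid_emit valid_moves valid_write_row valid_copy_symbol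
      valid_rulers) simp_all

section \<open>The reductions in both directions\<close>

lemma polytime_reducible_gadget:
  assumes "\<And>G. G \<in> input_graphs \<Longrightarrow> gadget G \<in> C"
  shows "polytime_reducible (graph_isomorphism UNIV) (graph_isomorphism C)"
proof -
  obtain p where p: "\<And>x. poly p x = reduction_time x"
    using is_poly_reduction_time by (auto simp: is_poly_def)
  have "computes_within (tm_of 10 3 reduction) (encode_graph G @ encode_graph H)
      (encode_graph (gadget G) @ encode_graph (gadget H))
      (poly p (length (encode_graph G @ encode_graph H)))" for G H
  proof -
    have "replicate 9 blank_tape = replicate (10 - 1) blank_tape"
      by simp
    from runs_reduction[of G H, unfolded this] show ?thesis
      unfolding p by (rule computes_within_tm_of[OF _ order.refl has_output_copied])
  qed
  then show ?thesis
    unfolding polytime_reducible_def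
    by (intro exI[of _ "\<lambda>(G, H). (gadget G, gadget H)"] exI[of _ "tm_of 10 3 reduction"] exI[of _ p])
       (auto simp: graph_isomorphism_def valid_tm_tm_of[OF valid_reduction] isomorphic_gadget_iff
         gadget_in_input_graphs assms simp del: length_append)
qed

text \<open>The restricted problem has fewer instances but the same answers, so the identity is a
  reduction. The program without states starts in its halting state, with the input already in place
  as output.\<close>

lemma polytime_reducible_GI: "polytime_reducible (graph_isomorphism C) (graph_isomorphism UNIV)"
proof -
  let ?M = "tm_of 1 3 (0, \<lambda>_ s. (0, []))"
  have "valid_tm ?M"
    by (rule valid_tm_tm_of) (simp_all add: valid_prog_def)
  moreover have "computes_within ?M w w 0" for w
    by (auto simp: computes_within_def init_config_def tm_of_def has_output_def input_tape_def)
  ultimately show ?thesis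
    unfolding polytime_reducible_def
    by (intro exI[of _ "\<lambda>x. x"] exI[of _ ?M] exI[of _ 0]) (auto simp: graph_isomorphism_def)
qed

theorem theorem3:
  "GI_complete (graph_isomorphism
     {G. free_of (complement (disjoint_union (copies 2 (path_graph 1)) (path_graph 2))) G \<and>
         free_of (disjoint_union (path_graph 2) (path_graph 4)) G})"
  unfolding GI_complete_def
proof (intro conjI polytime_reducible_GI polytime_reducible_gadget CollectI gadget_free_of_P2_P4)
  fix G :: "nat graph" assume "G \<in> input_graphs"
  then have "simple_graph G"
    by (simp add: input_graphs_def)
  then show "free_of (complement (disjoint_union (copies 2 (path_graph 1)) (path_graph 2))) (gadget G)"
    by (rule gadget_free_of_diamond)
qed

end
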